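(* There exists a function $\varepsilon:\mathbb{N}\to[0,\infty)$ with $\varepsilon(n)\to 0$ as $n\to\infty$ such that for every $n\ge 1$, every $n$-vertex tournament $G$ has an acyclic subgraph whose chromatic number is at least $n^{5/9-\varepsilon(n)}$.
   Context: A tournament is an orientation of a complete graph. A subgraph of an oriented graph is acyclic if it contains no directed cycle. The chromatic number of an oriented graph is the chromatic number of its underlying undirected graph. *)

theory Defs
  imports Complex_Main "Graph_Theory.Graph_Theory"
begin

text \<open>Undirected graphs are symmetric digraphs, as everywhere in Graph_Theory; the underlying
  undirected graph of a digraph \<open>G\<close> is \<open>mk_symmetric G\<close>.\<close>

locale oriented_graph = digraph +
  assumes no_opposite_arcs: "u \<rightarrow>\<^bsub>G\<^esub> v \<Longrightarrow> \<not> v \<rightarrow>\<^bsub>G\<^esub> u"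

locale tournament = oriented_graph +
  assumes underlying_complete:
    "complete_digraph (card (verts G)) (with_proj (mk_symmetric G))"

text \<open>The library's \<open>cycle\<close> is a directed closed walk of positive length without repeated
  vertices. (The library's \<open>forest\<close> has the same right-hand side, but is intended for symmetric
  digraphs.)\<close>

definition acyclic_digraph :: "('a, 'b) pre_digraph \<Rightarrow> bool" where
  "acyclic_digraph G \<longleftrightarrow> \<not> (\<exists>p. pre_digraph.cycle G p)"

definition proper_coloring :: "('a, 'b) pre_digraph \<Rightarrow> nat \<Rightarrow> ('a \<Rightarrow> nat) \<Rightarrow> bool" where
  "proper_coloring G k c \<longleftrightarrow>
     (\<forall>v\<in>verts G. c v < k) \<and> (\<forall>u v. u \<rightarrow>\<^bsub>G\<^esub> v \<longrightarrow> c u \<noteq> c v)"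

text \<open>Meaningful for finite loop-free graphs, for which a proper colouring always exists.\<close>

definition chromatic_number :: "('a, 'b) pre_digraph \<Rightarrow> nat" where
  "chromatic_number G = (LEAST k. \<exists>c. proper_coloring G k c)"

definition oriented_chromatic_number :: "('a, 'b) pre_digraph \<Rightarrow> nat" where
  "oriented_chromatic_number G = chromatic_number (with_proj (mk_symmetric G))"

lemma arcs_ends_mk_symmetric_iff:
  "(u, v) \<in> arcs_ends (with_proj (mk_symmetric G)) \<longleftrightarrow> u \<rightarrow>\<^bsub>G\<^esub> v \<or> v \<rightarrow>\<^bsub>G\<^esub> u"
  by (auto simp: mk_symmetric_def arcs_ends_conv)

lemma (in tournament) adjacent_iff:
  assumes "u \<in> verts G" "v \<in> verts G"
  shows "(u \<rightarrow>\<^bsub>G\<^esub> v \<or> v \<rightarrow>\<^bsub>G\<^esub> u) \<longleftrightarrow> u \<noteq> v"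
proof -
  have "(u, v) \<in> arcs_ends (with_proj (mk_symmetric G)) \<longleftrightarrow> u \<noteq> v"
    using underlying_complete assms
    by (auto simp: complete_digraph_def mk_symmetric_def)
  then show ?thesis by (simp only: arcs_ends_mk_symmetric_iff)
qed

lemma tournamentI:
  assumes "digraph G"
    and "\<And>u v. u \<rightarrow>\<^bsub>G\<^esub> v \<Longrightarrow> \<not> v \<rightarrow>\<^bsub>G\<^esub> u"
    and "\<And>u v. u \<in> verts G \<Longrightarrow> v \<in> verts G \<Longrightarrow> u \<noteq> v \<Longrightarrow> u \<rightarrow>\<^bsub>G\<^esub> v \<or> v \<rightarrow>\<^bsub>G\<^esub> u"
  shows "tournament G"
proof -
  interpret digraph G by fact
  let ?U = "with_proj (mk_symmetric G)"
  have "(u, v) \<in> arcs_ends ?U \<longleftrightarrow> u \<in> verts G \<and> v \<in> verts G \<and> u \<noteq> v" for u v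
    unfolding arcs_ends_mk_symmetric_iff
    using assms(3) adj_in_verts adj_not_same by blast
  then have ends: "arcs_ends ?U = {(u,v). (u,v) \<in> verts G \<times> verts G \<and> u \<noteq> v}"
    by (simp only: set_eq_iff split_paired_all) simp
  have arcs: "arcs ?U = arcs_ends ?U" by (auto simp: arcs_ends_conv)
  have "finite {(u,v). u \<in> verts G \<and> v \<in> verts G \<and> u \<noteq> v}"
    by (rule finite_subset[of _ "verts G \<times> verts G"]) auto
  moreover have "sym (arcs_ends ?U)" unfolding ends by (auto intro: symI)
  ultimately have "graph ?U"
    using arcs ends
    by unfold_locales (auto simp: mk_symmetric_def symmetric_def arc_to_ends_def dest: no_loops)
  then have "complete_digraph (card (verts G)) ?U"
    unfolding complete_digraph_def ends by (simp add: mk_symmetric_def)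
  with assms(2) show ?thesis by unfold_locales
qed

lemma proper_coloring_chromatic_number:
  assumes "fin_digraph G" "loopfree_digraph G"
  shows "\<exists>c. proper_coloring G (chromatic_number G) c"
proof -
  interpret fin_digraph G by fact
  interpret loopfree_digraph G by fact
  obtain c where c: "bij_betw c (verts G) {0..<card (verts G)}"
    using ex_bij_betw_finite_nat[OF finite_verts] by blast
  have "proper_coloring G (card (verts G)) c"
    unfolding proper_coloring_def
  proof (intro conjI ballI allI impI)
    show "c v < card (verts G)" if "v \<in> verts G" for v
      using c that by (auto simp: bij_betw_def)
    show "c u \<noteq> c v" if "u \<rightarrow>\<^bsub>G\<^esub> v" for u v
      using c adj_in_verts[OF that] adj_not_same that by (metis bij_betw_def inj_on_eq_iff)
  qed
  then show ?thesis unfolding chromatic_number_def by (intro LeastI) blast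
qed

end

theory Submission
  imports Defs "HOL-Combinatorics.Permutations" "HOL-Analysis.Convex" "HOL-Real_Asymp.Real_Asymp"
begin

text \<open>
  For an ordering of the vertices, the independent sets of the graph of forward arcs are the
  \<^emph>\<open>backward\<close> sets, all of whose arcs go down in the ordering; a fixed set \<open>U\<close> is backward for a
  random ordering with probability at most \<open>1 / card U!\<close>. Let \<open>m = \<lceil>n powr (4/9)\<rceil>\<close>. If there are
  fewer than \<open>m!\<close> transitive sets of size \<open>m\<close>, then some ordering has no backward set of size
  \<open>m\<close>, and its forward graph needs about \<open>n / m\<close> colours.

  Otherwise a container argument in the style of Kleitman and Winston applies. Reveal a transitive
  set by querying vertices that either conflict with many candidates or split a large level of
  candidates evenly. Few answers are positive, so if the candidates always dropped below \<open>m\<^sup>2 / 28\<close>, there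
  would be fewer than \<open>m!\<close> transitive sets. Hence there is a set of at least \<open>m\<^sup>2 / 28\<close> vertices
  with a linear arrangement of levels in which all levels have size at most about
  \<open>s = m powr (3/2)\<close> and every vertex has few arcs against the arrangement. Merging the levels into
  consecutive blocks of size about \<open>s\<close> and ordering each block randomly, all backward sets have size
  at most \<open>sqrt s\<close> up to logarithmic factors, and the forward graph needs about
  \<open>m\<^sup>2 / sqrt s = m powr (5/4) = n powr (5/9)\<close> colours.
\<close>

subsection \<open>Random orderings of a tournament\<close>

definition backward :: "('a \<Rightarrow> 'a \<Rightarrow> bool) \<Rightarrow> ('a \<Rightarrow> nat) \<Rightarrow> 'a set \<Rightarrow> bool" where
  "backward R g U \<longleftrightarrow> (\<forall>x\<in>U. \<forall>y\<in>U. R x y \<longrightarrow> g y < g x)"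

lemma backward_subset: "backward R g U \<Longrightarrow> W \<subseteq> U \<Longrightarrow> backward R g W"
  unfolding backward_def by blast

text \<open>A single term of the exponential series of \<open>exp m\<close> is at most the whole
  sum. This replaces Stirling's formula throughout.\<close>

lemma power_self_le_exp_fact: "real m ^ m \<le> exp (real m) * fact m"
proof -
  have "(\<Sum>k\<in>{m}. inverse (fact k) * real m ^ k) \<le> (\<Sum>k. inverse (fact k) * real m ^ k)"
    by (rule sum_le_suminf) (auto intro: summable_exp)
  then have "inverse (fact m) * real m ^ m \<le> exp (real m)"
    by (simp add: exp_def divide_inverse mult.commute scaleR_conv_of_real)
  then show ?thesis by (simp add: field_simps)
qed

lemma binomial_le_power_divide_fact: "real (n choose k) \<le> real n ^ k / fact k"
  proof -
  have "real ((n choose k) * fact k) \<le> real (n ^ k)"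
    using binomial_fact_pow by (simp only: of_nat_le_iff)
  then show ?thesis by (simp add: field_simps)
qed

lemma half_le_ln_Suc:
  assumes "1 \<le> n"
  shows "1 / 2 \<le> ln (real n + 1)"
proof -
  have "ln (1/2) \<le> (1/2 - 1 :: real)" by (rule ln_le_minus_one) simp
  then have "1/2 \<le> ln (2 :: real)" by (simp add: ln_div)
  also have "\<dots> \<le> ln (real n + 1)" using assms by (intro ln_mono) auto
  finally show ?thesis .
qed

text \<open>Only the arc relation on a finite vertex set is kept, so that restricting to a subset
  and reversing all arcs give further instances without building new digraphs.\<close>

locale tournament_relation =
  fixes V :: "'a set" and R :: "'a \<Rightarrow> 'a \<Rightarrow> bool"
  assumes finite_V: "finite V"
    and irrefl: "x \<in> V \<Longrightarrow> \<not> R x x"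
    and total: "x \<in> V \<Longrightarrow> y \<in> V \<Longrightarrow> x \<noteq> y \<Longrightarrow> R x y \<longleftrightarrow> \<not> R y x"
begin

lemma tournament_relation_subset: "C \<subseteq> V \<Longrightarrow> tournament_relation C R"
proof
  assume C: "C \<subseteq> V"
  show "finite C" using C finite_V by (rule finite_subset)
  show "\<not> R x x" if "x \<in> C" for x using that C irrefl by blast
  show "R x y \<longleftrightarrow> \<not> R y x" if "x \<in> C" "y \<in> C" "x \<noteq> y" for x y
    using that C total[of x y] by blast
qed

lemma backward_less_iff:
  assumes "U \<subseteq> V" "backward R g U" "x \<in> U" "y \<in> U"
  shows "g x < g y \<longleftrightarrow> R y x"
proof (cases "x = y")
  case True
  then show ?thesis using assms irrefl by auto
next
  case False
  then have "R x y \<longleftrightarrow> \<not> R y x" using assms total by blast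
  then show ?thesis using assms unfolding backward_def by (metis less_asym)
qed

text \<open>Both \<open>g\<close> and \<open>g \<circ> p\<close> order \<open>U\<close> as dictated
  by \<open>R\<close>, so \<open>p\<close> carries the part of \<open>U\<close> below
  \<open>x\<close> onto the part below \<open>p x\<close>. Equal sizes force
  \<open>g (p x) = g x\<close>, and two distinct vertices of \<open>U\<close> cannot share a
  value.\<close>

lemma backward_permutation_unique:
  assumes U: "U \<subseteq> V" and p: "p permutes U"
    and g: "backward R g U" and gp: "backward R (g \<circ> p) U"
  shows "p = id"
proof -
  have fin: "finite U" using U finite_V finite_subset by blast
  have pU: "p x \<in> U" if "x \<in> U" for x using p that by (simp add: permutes_in_image)
  have eq: "g (p x) = g x" if x: "x \<in> U" for x
  proof -
    have inj: "inj_on p {u \<in> U. g u < g x}" using p by (meson inj_on_subset permutes_inj subset_UNIV)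
    have "p ` {u \<in> U. g u < g x} = {u \<in> U. g u < g (p x)}"
    proof (intro equalityI subsetI)
      fix y assume "y \<in> p ` {u \<in> U. g u < g x}"
      then show "y \<in> {u \<in> U. g u < g (p x)}"
        using backward_less_iff[OF U g] backward_less_iff[OF U gp] x pU by auto
    next
      fix y assume y: "y \<in> {u \<in> U. g u < g (p x)}"
      then obtain u where u: "u \<in> U" "y = p u"
        using permutes_image[OF p] by blast
      with y show "y \<in> p ` {u \<in> U. g u < g x}"
        using backward_less_iff[OF U g] backward_less_iff[OF U gp] x by auto
    qed
    then have card: "card {u \<in> U. g u < g x} = card {u \<in> U. g u < g (p x)}"
      using card_image[OF inj] by simp
    show ?thesis
    proof (rule ccontr)
      assume "g (p x) \<noteq> g x"
      then consider "g x < g (p x)" | "g (p x) < g x" by linarith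
      then show False
      proof cases
        case 1
        then have "{u \<in> U. g u < g x} \<subset> {u \<in> U. g u < g (p x)}" using x by auto
        from psubset_card_mono[OF _ this] fin card show False by simp
      next
        case 2
        then have "{u \<in> U. g u < g (p x)} \<subset> {u \<in> U. g u < g x}" using x pU by auto
        from psubset_card_mono[OF _ this] fin card show False by simp
      qed
    qed
  qed
  have "p x = x" for x
  proof (cases "x \<in> U")
    case True
    have "\<not> R (p x) x" "\<not> R x (p x)"
      using backward_less_iff[OF U g True pU[OF True]] backward_less_iff[OF U g pU[OF True] True]
        eq[OF True] by auto
    then show ?thesis using total True pU U by blast
  next
    case False then show ?thesis using p by (simp add: permutes_def)
  qed
  then show ?thesis by auto
qed

text \<open>By uniqueness of the backward order on \<open>U\<close>, composing the good permutations
  with all permutations of \<open>U\<close> never yields the same permutation twice. Divided by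
  \<open>fact (card V)\<close>, this is the probability bound
  \<open>1 / fact (card U)\<close>.\<close>

lemma card_backward_permutations:
  assumes U: "U \<subseteq> V"
  shows "card {p. p permutes V \<and> backward R (l \<circ> p) U} * fact (card U) \<le> fact (card V)"
proof -
  let ?A = "{p. p permutes V \<and> backward R (l \<circ> p) U}" and ?B = "{q. q permutes U}"
  have fin: "finite U" using U finite_V finite_subset by blast
  have "inj_on (\<lambda>(p, q). p \<circ> q) (?A \<times> ?B)"
  proof (rule inj_onI, clarify)
    fix p q p' q'
    assume p: "p permutes V" "backward R (l \<circ> p) U" and q: "q permutes U"
      and p': "p' permutes V" "backward R (l \<circ> p') U" and q': "q' permutes U"
      and eq: "p \<circ> q = p' \<circ> q'"
    have perm: "q \<circ> inv q' permutes U" using q q' by (simp add: permutes_compose permutes_inv)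
    have "p' = p' \<circ> (q' \<circ> inv q')" using q' by (simp add: permutes_inv_o)
    also have "\<dots> = p \<circ> (q \<circ> inv q')" using eq by (simp add: o_assoc)
    finally have p'_eq: "p' = p \<circ> (q \<circ> inv q')" .
    have "q \<circ> inv q' = id"
      by (rule backward_permutation_unique[OF U perm p(2)]) (use p'(2) p'_eq in \<open>simp add: o_assoc\<close>)
    then have "q = q'" using q' by (metis comp_id fun.map_comp id_comp permutes_inv_o(2))
    moreover have "p = p'" using p'_eq \<open>q \<circ> inv q' = id\<close> by simp
    ultimately show "p = p' \<and> q = q'" by simp
  qed
  moreover have "(\<lambda>(p, q). p \<circ> q) ` (?A \<times> ?B) \<subseteq> {p. p permutes V}"
    using permutes_compose permutes_subset[OF _ U] by fastforce
  ultimately have "card (?A \<times> ?B) \<le> card {p. p permutes V}"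
    by (rule card_inj_on_le) (rule finite_permutations[OF finite_V])
  then show ?thesis
    using fin finite_V by (simp add: card_cartesian_product card_permutations)
qed

text \<open>Union bound over \<open>F\<close>. The values stay below \<open>card V\<close> so that
  such orderings can later be stacked level above level.\<close>

lemma exists_ordering_avoiding:
  assumes F: "F \<subseteq> Pow V" and sum: "(\<Sum>U\<in>F. 1 / fact (card U)) < (1 :: real)"
  shows "\<exists>g. inj_on g V \<and> g ` V \<subseteq> {..<card V} \<and> (\<forall>U\<in>F. \<not> backward R g U)"
proof -
  obtain l where l: "bij_betw l V {0..<card V}"
    using ex_bij_betw_finite_nat[OF finite_V] by blast
  have finF: "finite F"
    by (rule finite_subset[of _ "Pow V"]) (use F finite_V in auto)
  let ?A = "\<lambda>U. {p. p permutes V \<and> backward R (l \<circ> p) U}"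
  have finA: "finite (?A U)" for U
    using finite_permutations[OF finite_V] by (rule rev_finite_subset) auto
  have "real (card (\<Union>U\<in>F. ?A U)) \<le> (\<Sum>U\<in>F. real (card (?A U)))"
    using card_UN_le[OF finF, of ?A] by (simp flip: of_nat_sum)
  also have "\<dots> \<le> (\<Sum>U\<in>F. fact (card V) * (1 / fact (card U)))"
  proof (rule sum_mono)
    fix U assume "U \<in> F"
    then have "U \<subseteq> V" using F by blast
    then have "real (card (?A U) * fact (card U)) \<le> real (fact (card V))"
      by (simp only: of_nat_le_iff card_backward_permutations)
    then show "real (card (?A U)) \<le> fact (card V) * (1 / fact (card U))"
      by (simp add: field_simps)
  qed
  also have "\<dots> = fact (card V) * (\<Sum>U\<in>F. 1 / fact (card U))" by (rule sum_distrib_left[symmetric])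
  also have "\<dots> < fact (card V)" using sum by simp
  also have "\<dots> = real (card {p. p permutes V})"
    using card_permutations[OF refl finite_V] by simp
  finally have "card (\<Union>U\<in>F. ?A U) < card {p. p permutes V}" by (simp only: of_nat_less_iff)
  then have "\<not> {p. p permutes V} \<subseteq> (\<Union>U\<in>F. ?A U)"
    using card_mono[of "\<Union>U\<in>F. ?A U" "{p. p permutes V}"] finF finA by auto
  then obtain p where p: "p permutes V" "\<forall>U\<in>F. \<not> backward R (l \<circ> p) U" by auto
  have "inj_on (l \<circ> p) V" "(l \<circ> p) ` V \<subseteq> {..<card V}"
    using l permutes_inj_on[OF p(1), of V] permutes_image[OF p(1)]
    by (auto simp: bij_betw_def lessThan_atLeast0 simp flip: image_comp intro!: comp_inj_on)
  then show ?thesis using p(2) by blast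
qed

end

subsection \<open>Containers for transitive sets\<close>

text \<open>The function \<open>f\<close> carries what earlier queries revealed about the order
  inside the set; for constant \<open>f\<close> these are all transitive \<open>k\<close>-subsets of
  \<open>C\<close>.\<close>

definition transitive_sets :: "('a \<Rightarrow> 'a \<Rightarrow> bool) \<Rightarrow> 'a set \<Rightarrow> ('a \<Rightarrow> nat) \<Rightarrow> nat \<Rightarrow> 'a set set" where
  "transitive_sets R C f k =
     {T. T \<subseteq> C \<and> card T = k \<and> transp_on T R \<and> (\<forall>x\<in>T. \<forall>y\<in>T. R x y \<longrightarrow> f x \<le> f y)}"

text \<open>The vertices joined to \<open>v\<close> by an arc against the levels; none of them
  shares a member of \<open>transitive_sets\<close> with \<open>v\<close>.\<close>

definition conflicts :: "('a \<Rightarrow> 'a \<Rightarrow> bool) \<Rightarrow> 'a set \<Rightarrow> ('a \<Rightarrow> nat) \<Rightarrow> 'a \<Rightarrow> 'a set" where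
  "conflicts R C f v = {w \<in> C. f w < f v \<and> R v w \<or> f v < f w \<and> R w v}"

definition level :: "'a set \<Rightarrow> ('a \<Rightarrow> nat) \<Rightarrow> 'a \<Rightarrow> 'a set" where
  "level C f v = {w \<in> C. f w = f v}"

text \<open>Once \<open>v\<close> is known to lie in a transitive set \<open>T\<close>, the rest of \<open>T\<close> avoids the conflicts of \<open>v\<close>
  and, by transitivity, has its elements of the level of \<open>v\<close> sorted by whether they precede or
  succeed \<open>v\<close>.\<close>

definition split_levels :: "('a \<Rightarrow> 'a \<Rightarrow> bool) \<Rightarrow> ('a \<Rightarrow> nat) \<Rightarrow> 'a \<Rightarrow> 'a \<Rightarrow> nat" where
  "split_levels R f v w = 2 * f w + of_bool (R v w)"

text \<open>Upper bound on how often a set can be found to contain the queried vertex: the first summand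
  pays for vertices with at least \<open>\<beta> * (card C + 1)\<close> conflicts, the second one for balanced
  vertices of a level of size at least \<open>s\<close>. The scale 4 comes from \<open>ln (4/3) \<ge> 1/4\<close>.\<close>

definition potential :: "real \<Rightarrow> real \<Rightarrow> 'a set \<Rightarrow> ('a \<Rightarrow> nat) \<Rightarrow> real" where
  "potential \<beta> s C f = ln (real (card C) + 1) / \<beta> + 4 / s * (\<Sum>w\<in>C. ln (real (card (level C f w))))"

section \<open>Decrease of the potential\<close>

lemma split_levels_less: "f x < f y \<Longrightarrow> split_levels R f v x < split_levels R f v y"
  by (auto simp: split_levels_def)

lemma split_levels_eq_iff:
  "split_levels R f v x = split_levels R f v y \<longleftrightarrow> f x = f y \<and> (R v x \<longleftrightarrow> R v y)"
proof
  assume "split_levels R f v x = split_levels R f v y"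
  moreover from this have "f x = f y"
    using split_levels_less[of f x y] split_levels_less[of f y x] by (metis less_irrefl nat_neq_iff)
  ultimately show "f x = f y \<and> (R v x \<longleftrightarrow> R v y)" by (cases "R v x"; cases "R v y"; simp add: split_levels_def)
qed (simp add: split_levels_def)

lemma finite_level: "finite C \<Longrightarrow> finite (level C f v)"
  by (simp add: level_def)

lemma card_level_pos: "finite C \<Longrightarrow> v \<in> C \<Longrightarrow> 0 < card (level C f v)"
  unfolding level_def by (subst card_gt_0_iff) auto

lemma potential_nonneg:
  assumes "0 < \<beta>" "0 < s" "finite C"
  shows "0 \<le> potential \<beta> s C f"
proof -
  have "0 \<le> (\<Sum>w\<in>C. ln (real (card (level C f w))))"
    using card_level_pos[OF assms(3)] by (intro sum_nonneg ln_ge_zero) (simp add: Suc_le_eq)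
  then show ?thesis using assms unfolding potential_def by simp
qed

text \<open>Each new level lies inside an old one, and a removed vertex had contributed the
  logarithm of a number at least 1.\<close>

lemma sum_ln_card_level_mono:
  assumes C: "finite C" "C' \<subseteq> C" and f: "\<And>u w. u \<in> C' \<Longrightarrow> w \<in> C' \<Longrightarrow> f' u = f' w \<Longrightarrow> f u = f w"
  shows "(\<Sum>w\<in>C'. ln (real (card (level C' f' w)))) \<le> (\<Sum>w\<in>C. ln (real (card (level C f w))))"
proof -
  have fin: "finite C'" using C finite_subset by blast
  have "(\<Sum>w\<in>C'. ln (real (card (level C' f' w)))) \<le> (\<Sum>w\<in>C'. ln (real (card (level C f w))))"
  proof (rule sum_mono)
    fix w assume w: "w \<in> C'"
    have "card (level C' f' w) \<le> card (level C f w)"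
      by (rule card_mono[OF finite_level[OF C(1)]]) (use C(2) f w in \<open>unfold level_def, blast\<close>)
    then show "ln (real (card (level C' f' w))) \<le> ln (real (card (level C f w)))"
      using card_level_pos[OF fin w, of f'] by (intro ln_mono) auto
  qed
  also have "\<dots> \<le> (\<Sum>w\<in>C. ln (real (card (level C f w))))"
    using C card_level_pos[OF C(1)] by (intro sum_mono2) (auto simp: Suc_le_eq)
  finally show ?thesis .
qed

lemma potential_mono:
  assumes "0 < \<beta>" "0 < s" "finite C" "C' \<subseteq> C"
    and "\<And>u w. u \<in> C' \<Longrightarrow> w \<in> C' \<Longrightarrow> f' u = f' w \<Longrightarrow> f u = f w"
  shows "potential \<beta> s C' f' \<le> potential \<beta> s C f"
  unfolding potential_def
proof (intro add_mono mult_left_mono divide_right_mono sum_ln_card_level_mono)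
  show "ln (real (card C') + 1) \<le> ln (real (card C) + 1)"
    using card_mono[OF assms(3,4)] by (intro ln_mono) auto
  show "f u = f w" if "u \<in> C'" "w \<in> C'" "f' u = f' w" for u w using assms(5) that by blast
qed (use assms(1-4) in auto)

text \<open>Losing a fraction \<open>\<beta>\<close> lowers the logarithm by at least
  \<open>\<beta>\<close>, since \<open>ln (1 - \<beta>) \<le> - \<beta>\<close>; the first summand
  of the potential divides this by \<open>\<beta>\<close>.\<close>

lemma potential_drop_shrink:
  assumes "0 < \<beta>" "0 < s" "finite C" "C' \<subseteq> C"
    and "\<And>u w. u \<in> C' \<Longrightarrow> w \<in> C' \<Longrightarrow> f' u = f' w \<Longrightarrow> f u = f w"
    and card: "real (card C') + \<beta> * (real (card C) + 1) \<le> real (card C)"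
  shows "potential \<beta> s C' f' \<le> potential \<beta> s C f - 1"
proof -
  \<comment> \<open>The shift by one keeps the logarithm meaningful for empty \<open>C'\<close> and
    turns the hypothesis into a clean factor \<open>1 - \<beta>\<close>.\<close>
  have le: "real (card C') + 1 \<le> (1 - \<beta>) * (real (card C) + 1)" using card by (simp add: algebra_simps)
  then have pos: "0 < 1 - \<beta>"
    by (smt (verit) mult_nonpos_nonneg of_nat_0_le_iff)
  have "ln (real (card C') + 1) \<le> ln ((1 - \<beta>) * (real (card C) + 1))"
    using le by (intro ln_mono) auto
  also have "\<dots> = ln (1 - \<beta>) + ln (real (card C) + 1)" using pos by (intro ln_mult_pos) auto
  also have "\<dots> \<le> ln (real (card C) + 1) - \<beta>" using ln_le_minus_one[OF pos] by simp
  finally have "ln (real (card C') + 1) / \<beta> \<le> ln (real (card C) + 1) / \<beta> - 1"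
    using assms(1) by (simp add: field_simps)
  moreover have "4 / s * (\<Sum>w\<in>C'. ln (real (card (level C' f' w))))
      \<le> 4 / s * (\<Sum>w\<in>C. ln (real (card (level C f w))))"
    using assms(2-5) by (intro mult_left_mono sum_ln_card_level_mono) (assumption | simp)+
  ultimately show ?thesis unfolding potential_def by linarith
qed

text \<open>Each of the at least \<open>s\<close> vertices in the level of \<open>v\<close> loses at
  least \<open>1/4\<close> in its logarithm, whether it survives in a smaller level or disappears.
  The factor \<open>4 / s\<close> turns the total into 1.\<close>

lemma potential_drop_split:
  assumes "0 < \<beta>" "1 < s" "finite C" "C' \<subseteq> C"
    and f: "\<And>u w. u \<in> C' \<Longrightarrow> w \<in> C' \<Longrightarrow> f' u = f' w \<Longrightarrow> f u = f w"
    and large: "s \<le> real (card (level C f v))"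
    and small: "\<And>w. w \<in> C' \<Longrightarrow> f w = f v \<Longrightarrow> 4 * card (level C' f' w) \<le> 3 * card (level C f v)"
  shows "potential \<beta> s C' f' \<le> potential \<beta> s C f - 1"
proof -
  let ?a = "real (card (level C f v))"
  have fin: "finite C'" using assms(3,4) finite_subset by blast
  have a: "2 \<le> ?a" using large assms(2) by simp
  \<comment> \<open>The discount \<open>1/4\<close> is charged to the whole old level. As
    \<open>h\<close> stays nonnegative, the sum over \<open>C'\<close> can be extended to
    \<open>C\<close>, which charges removed vertices too.\<close>
  define h where "h w = ln (real (card (level C f w))) - of_bool (f w = f v) / 4" for w
  have "ln (3/4) \<le> (3/4 - 1 :: real)" by (rule ln_le_minus_one) simp
  then have ln34: "ln (3/4) \<le> (- 1/4 :: real)" by simp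
  have "ln (1/2) \<le> (1/2 - 1 :: real)" by (rule ln_le_minus_one) simp
  then have "1/2 \<le> ln (2 :: real)" by (simp add: ln_div)
  also have "\<dots> \<le> ln ?a" using a by (intro ln_mono) auto
  finally have ln_a: "1/2 \<le> ln ?a" .
  have level_eq: "level C f w = level C f v" if "f w = f v" for w using that by (simp add: level_def)
  have h_nonneg: "0 \<le> h w" if "w \<in> C" for w
    using card_level_pos[OF assms(3) that, of f] ln_a level_eq[of w]
    by (auto simp: h_def Suc_le_eq)
  have "(\<Sum>w\<in>C'. ln (real (card (level C' f' w)))) \<le> (\<Sum>w\<in>C'. h w)"
  proof (rule sum_mono)
    fix w assume w: "w \<in> C'"
    have pos: "0 < card (level C' f' w)" using card_level_pos[OF fin w] .
    show "ln (real (card (level C' f' w))) \<le> h w"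
    proof (cases "f w = f v")
      case True
      have "real (card (level C' f' w)) \<le> 3/4 * ?a" using small[OF w True] by linarith
      then have "ln (real (card (level C' f' w))) \<le> ln (3/4 * ?a)" using pos by (intro ln_mono) auto
      also have "\<dots> = ln (3/4) + ln ?a" using a by (intro ln_mult_pos) auto
      also have "\<dots> \<le> h w" using ln34 True level_eq[OF True] by (simp add: h_def)
      finally show ?thesis .
    next
      case False
      have "card (level C' f' w) \<le> card (level C f w)"
        by (rule card_mono[OF finite_level[OF assms(3)]]) (use assms(4) f w in \<open>unfold level_def, blast\<close>)
      then show ?thesis using pos False by (auto simp: h_def intro!: ln_mono)
    qed
  qed
  also have "\<dots> \<le> (\<Sum>w\<in>C. h w)" using assms(3,4) h_nonneg by (intro sum_mono2) auto
  also have "\<dots> = (\<Sum>w\<in>C. ln (real (card (level C f w)))) - (\<Sum>w\<in>C. of_bool (f w = f v)) / 4"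
    by (simp add: h_def sum_subtractf sum_divide_distrib)
  also have "(\<Sum>w\<in>C. of_bool (f w = f v)) = ?a"
  proof -
    have "level C f v = C \<inter> {w. f w = f v}" by (auto simp: level_def)
    then show ?thesis using assms(3) by (simp add: sum_of_bool_eq)
  qed
  finally have drop: "(\<Sum>w\<in>C'. ln (real (card (level C' f' w))))
      \<le> (\<Sum>w\<in>C. ln (real (card (level C f w)))) - s / 4" using large by linarith
  have "4 / s * (\<Sum>w\<in>C'. ln (real (card (level C' f' w))))
      \<le> 4 / s * ((\<Sum>w\<in>C. ln (real (card (level C f w)))) - s / 4)"
    using assms(2) by (intro mult_left_mono[OF drop]) auto
  also have "\<dots> = 4 / s * (\<Sum>w\<in>C. ln (real (card (level C f w)))) - 1"
    using assms(2) by (simp add: right_diff_distrib)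
  finally have "4 / s * (\<Sum>w\<in>C'. ln (real (card (level C' f' w))))
      \<le> 4 / s * (\<Sum>w\<in>C. ln (real (card (level C f w)))) - 1" .
  moreover have "ln (real (card C') + 1) / \<beta> \<le> ln (real (card C) + 1) / \<beta>"
    using card_mono[OF assms(3,4)] assms(1) by (intro divide_right_mono ln_mono) auto
  ultimately show ?thesis unfolding potential_def by linarith
qed

lemma card_transitive_sets_le:
  assumes "finite C"
  shows "card (transitive_sets R C f k) \<le> card C choose k"
proof -
  have "card (transitive_sets R C f k) \<le> card {T. T \<subseteq> C \<and> card T = k}"
    by (rule card_mono) (use assms in \<open>auto simp: transitive_sets_def\<close>)
  then show ?thesis using n_subsets[OF assms] by simp
qed

lemma finite_transitive_sets: "finite C \<Longrightarrow> finite (transitive_sets R C f k)"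
  unfolding transitive_sets_def by simp

text \<open>Passing from \<open>j\<close> to \<open>Suc j\<close> multiplies by
  \<open>x / Suc j\<close>, which is at least 1 as long as
  \<open>Suc j \<le> m \<le> x\<close>.\<close>

lemma power_divide_fact_mono:
  fixes x :: real
  assumes "k \<le> m" "real m \<le> x"
  shows "x ^ k / fact k \<le> x ^ m / fact m"
  using assms
proof (induction m rule: dec_induct)
  case (step j)
  have "x ^ j / fact j \<le> x ^ j / fact j * (x / real (Suc j))"
    using step mult_left_mono[of 1 "x / real (Suc j)" "x ^ j / fact j"] by simp
  also have "\<dots> = x ^ Suc j / fact (Suc j)" by (simp add: field_simps)
  finally show ?case using step by simp
qed simp

section \<open>Balanced vertices and the branching count of transitive sets\<close>

context tournament_relation
begin

text \<open>Out-degrees and in-degrees within \<open>X\<close> have the same sum, while the two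
  degrees of one vertex add up to less than \<open>card X\<close>.\<close>

lemma exists_low_out_degree:
  assumes "X \<subseteq> V" "X \<noteq> {}"
  shows "\<exists>v\<in>X. 2 * card {w \<in> X. R v w} < card X"
proof (rule ccontr)
  assume "\<not> ?thesis"
  then have high: "card X \<le> 2 * card {w \<in> X. R v w}" if "v \<in> X" for v using that by force
  have fin: "finite X" using assms(1) finite_V finite_subset by blast
  have out: "(\<Sum>v\<in>X. card {w \<in> X. R v w}) = (\<Sum>v\<in>X. card {w \<in> X. R w v})"
    using sum_multicount_gen[OF fin fin, of R "\<lambda>v. card {w \<in> X. R w v}"] by simp
  have "card {w \<in> X. R v w} + card {w \<in> X. R w v} < card X" if v: "v \<in> X" for v
  proof -
    have "card {w \<in> X. R v w} + card {w \<in> X. R w v} = card ({w \<in> X. R v w} \<union> {w \<in> X. R w v})"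
      using fin v assms(1) irrefl total by (intro card_Un_disjoint[symmetric]) (auto, metis subsetD)
    also have "\<dots> < card X"
      using fin v assms(1) irrefl by (intro psubset_card_mono) auto
    finally show ?thesis .
  qed
  then have "(\<Sum>v\<in>X. card {w \<in> X. R v w} + card {w \<in> X. R w v}) < (\<Sum>v\<in>X. card X)"
    using assms(2) fin by (intro sum_strict_mono) auto
  moreover have "(\<Sum>v\<in>X. card X) \<le> (\<Sum>v\<in>X. 2 * card {w \<in> X. R v w})"
    using high by (rule sum_mono)
  ultimately show False using out by (simp add: sum.distrib flip: sum_distrib_left)
qed

text \<open>Some vertex of the exceptional set \<open>X\<close> has fewer than
  \<open>card X / 2\<close> out-neighbours in \<open>X\<close>, hence fewer than
  \<open>card A - card X / 2\<close> in \<open>A\<close>. Exceeding \<open>3/4\<close> of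
  \<open>card A\<close> then forces \<open>X\<close> below half of \<open>A\<close>.\<close>

lemma card_high_out_degree:
  assumes "A \<subseteq> V" "A \<noteq> {}"
  shows "2 * card {v \<in> A. 3 * card A < 4 * card {w \<in> A. R v w}} < card A"
proof -
  let ?X = "{v \<in> A. 3 * card A < 4 * card {w \<in> A. R v w}}"
  have fin: "finite A" using assms(1) finite_V finite_subset by blast
  show ?thesis
  proof (cases "?X = {}")
    case True
    then show ?thesis using assms(2) fin by (simp only: card.empty) (simp add: card_gt_0_iff)
  next
    case False
    then obtain v where v: "v \<in> ?X" "2 * card {w \<in> ?X. R v w} < card ?X"
      using exists_low_out_degree[of ?X] assms(1) by blast
    have "card {w \<in> A. R v w} \<le> card ({w \<in> ?X. R v w} \<union> (A - ?X))"
      by (rule card_mono) (use fin in auto)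
    also have "\<dots> \<le> card {w \<in> ?X. R v w} + card (A - ?X)" by (rule card_Un_le)
    also have "card (A - ?X) = card A - card ?X" by (rule card_Diff_subset) (use fin in auto)
    finally have "card {w \<in> A. R v w} \<le> card {w \<in> ?X. R v w} + (card A - card ?X)" .
    moreover have "card ?X \<le> card A" by (rule card_mono) (use fin in auto)
    moreover have "3 * card A < 4 * card {w \<in> A. R v w}" using v(1) by simp
    ultimately show ?thesis using v(2) by linarith
  qed
qed

lemma converse_tournament_relation: "tournament_relation V (\<lambda>x y. R y x)"
proof
  show "R y x \<longleftrightarrow> \<not> R x y" if "x \<in> V" "y \<in> V" "x \<noteq> y" for x y
    using total[of x y] that by blast
qed (use finite_V irrefl in auto)

text \<open>Fewer than half of the vertices fail in each direction, so the two exceptional sets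
  cannot cover \<open>A\<close>.\<close>

lemma exists_balanced_vertex:
  assumes "A \<subseteq> V" "A \<noteq> {}"
  shows "\<exists>v\<in>A. 4 * card {w \<in> A. R v w} \<le> 3 * card A \<and> 4 * card {w \<in> A. R w v} \<le> 3 * card A"
proof (rule ccontr)
  interpret converse: tournament_relation V "\<lambda>x y. R y x" by (rule converse_tournament_relation)
  let ?X = "{v \<in> A. 3 * card A < 4 * card {w \<in> A. R v w}}"
  let ?Y = "{v \<in> A. 3 * card A < 4 * card {w \<in> A. R w v}}"
  assume "\<not> ?thesis"
  then have "A \<subseteq> ?X \<union> ?Y" by force
  moreover have "finite A" using assms(1) finite_V finite_subset by blast
  ultimately have "card A \<le> card (?X \<union> ?Y)" by (intro card_mono) auto
  also have "\<dots> \<le> card ?X + card ?Y" by (rule card_Un_le)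
  finally show False
    using card_high_out_degree[OF assms] converse.card_high_out_degree[OF assms] by linarith
qed

text \<open>One query: is \<open>v\<close> in the set? A negative answer removes only
  \<open>v\<close>; a positive one also removes its conflicts, refines the levels and uses up one
  element.\<close>

lemma card_transitive_sets_branch:
  assumes C: "C \<subseteq> V" and v: "v \<in> C"
  shows "card (transitive_sets R C f (Suc k)) \<le> card (transitive_sets R (C - {v}) f (Suc k))
    + card (transitive_sets R (C - {v} - conflicts R C f v) (split_levels R f v) k)"
    (is "_ \<le> card ?A + card ?B")
proof -
  let ?T = "transitive_sets R C f (Suc k)"
  have finC: "finite C" using C finite_V finite_subset by blast
  have fin: "finite ?A" "finite ?B" using finC by (auto intro: finite_transitive_sets)
  have "?T \<subseteq> ?A \<union> insert v ` ?B"
  proof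
    fix T assume T: "T \<in> ?T"
    then have TC: "T \<subseteq> C" and card: "card T = Suc k" and trans: "transp_on T R"
      and f: "\<And>x y. x \<in> T \<Longrightarrow> y \<in> T \<Longrightarrow> R x y \<Longrightarrow> f x \<le> f y"
      by (auto simp: transitive_sets_def)
    show "T \<in> ?A \<union> insert v ` ?B"
    proof (cases "v \<in> T")
      case False
      then show ?thesis using T by (auto simp: transitive_sets_def)
    next
      case True
      have "T - {v} \<in> ?B"
        unfolding transitive_sets_def
      proof (intro CollectI conjI ballI impI)
        show "T - {v} \<subseteq> C - {v} - conflicts R C f v"
          using TC f True by (force simp: conflicts_def)
        show "card (T - {v}) = k" using card True by simp
        show "transp_on (T - {v}) R" using trans by (rule transp_on_subset) blast
        fix x y assume x: "x \<in> T - {v}" and y: "y \<in> T - {v}" and xy: "R x y"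
        \<comment> \<open>Transitivity forbids an arc from a successor of \<open>v\<close> to a
          predecessor of \<open>v\<close>, which is why predecessors get the lower half of a split
          level.\<close>
        have "R v x \<Longrightarrow> R v y" using trans True x y xy by (auto simp: transp_on_def)
        moreover have "f x \<le> f y" using f x y xy by blast
        ultimately show "split_levels R f v x \<le> split_levels R f v y"
          by (auto simp: split_levels_def)
      qed
      moreover have "T = insert v (T - {v})" using True by blast
      ultimately show ?thesis by blast
    qed
  qed
  then have "card ?T \<le> card (?A \<union> insert v ` ?B)" using fin by (intro card_mono) auto
  also have "\<dots> \<le> card ?A + card (insert v ` ?B)" by (rule card_Un_le)
  also have "card (insert v ` ?B) \<le> card ?B" using fin by (intro card_image_le)
  finally show ?thesis by simp
qed

text \<open>The potential bounds the number of positive answers, so their positions account for the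
  factor \<open>powr\<close>. Once at most \<open>M\<close> candidates remain, all subsets of the
  required size are counted.\<close>

lemma card_transitive_sets_bound:
  assumes \<beta>: "0 < \<beta>" and s: "1 < s" and M: "0 < M" "real m \<le> M"
    and bad: "\<And>C f. C \<subseteq> V \<Longrightarrow> M \<le> real (card C) \<Longrightarrow>
      (\<exists>v\<in>C. \<beta> * (real (card C) + 1) \<le> real (card (conflicts R C f v))) \<or>
      (\<exists>v\<in>C. s \<le> real (card (level C f v)))"
    and C: "C \<subseteq> V" and k: "k \<le> m"
  shows "real (card (transitive_sets R C f k))
    \<le> (real (card C) + 1) powr potential \<beta> s C f * (M ^ m / fact m)"
  using C k
proof (induction "card C" arbitrary: C f k rule: less_induct)
  case less
  note C = less.prems(1) and k = less.prems(2)
  have finC: "finite C" using C finite_V finite_subset by blast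
  have s0: "0 < s" using s by simp
  let ?B = "M ^ m / fact m"
  have B: "0 \<le> ?B" using M by simp
  have B1: "real (card (transitive_sets R C f k)) \<le> ?B" if "real (card C) ^ k / fact k \<le> M ^ k / fact k"
  proof -
    have "real (card (transitive_sets R C f k)) \<le> real (card C choose k)"
      using card_transitive_sets_le[OF finC] by (simp only: of_nat_le_iff)
    also have "\<dots> \<le> real (card C) ^ k / fact k" by (rule binomial_le_power_divide_fact)
    also note that
    also have "M ^ k / fact k \<le> ?B" using k M(2) by (rule power_divide_fact_mono)
    finally show ?thesis .
  qed
  have powr1: "1 \<le> (real (card C) + 1) powr potential \<beta> s C f"
    using potential_nonneg[OF \<beta> s0 finC] by (intro ge_one_powr_ge_zero) auto
  show ?case
  proof (cases "real (card C) \<le> M \<or> k = 0")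
    case True
    then have "real (card C) ^ k / fact k \<le> M ^ k / fact k"
    proof
      assume "real (card C) \<le> M"
      then show ?thesis by (intro divide_right_mono power_mono) simp_all
    qed simp
    then have "real (card (transitive_sets R C f k)) \<le> 1 * ?B" using B1 by simp
    also have "\<dots> \<le> (real (card C) + 1) powr potential \<beta> s C f * ?B"
      using powr1 B by (rule mult_right_mono)
    finally show ?thesis .
  next
    case False
    then obtain k' where k': "k = Suc k'" using not0_implies_Suc by blast
    have big: "M \<le> real (card C)" using False by simp
    define N where "N v = C - {v} - conflicts R C f v" for v
    have N_sub: "N v \<subseteq> C" for v by (auto simp: N_def)
    obtain v where v: "v \<in> C"
      and drop: "potential \<beta> s (N v) (split_levels R f v) \<le> potential \<beta> s C f - 1"
    proof -
      from bad[OF C big, of f] show thesis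
      proof (elim disjE bexE)
        fix v assume v: "v \<in> C" and conf: "\<beta> * (real (card C) + 1) \<le> real (card (conflicts R C f v))"
        have sub: "conflicts R C f v \<subseteq> C" by (auto simp: conflicts_def)
        have "card (N v) \<le> card (C - conflicts R C f v)"
          using finC by (intro card_mono) (auto simp: N_def)
        also have "\<dots> = card C - card (conflicts R C f v)"
          using sub finC by (intro card_Diff_subset) (auto intro: finite_subset)
        finally have "real (card (N v)) + real (card (conflicts R C f v)) \<le> real (card C)"
          using card_mono[OF finC sub] by linarith
        then have "potential \<beta> s (N v) (split_levels R f v) \<le> potential \<beta> s C f - 1"
          using conf by (intro potential_drop_shrink[OF \<beta> s0 finC N_sub]) (auto simp: split_levels_eq_iff)
        then show thesis using v that by blast
      next
        \<comment> \<open>In a large level the queried vertex is not \<open>u\<close> but a balanced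
          vertex, so that both halves of the split level are small.\<close>
        fix u assume u: "u \<in> C" and large: "s \<le> real (card (level C f u))"
        have "level C f u \<subseteq> V" "level C f u \<noteq> {}" using u C by (auto simp: level_def)
        then obtain v where v: "v \<in> level C f u"
          and bal: "4 * card {w \<in> level C f u. R v w} \<le> 3 * card (level C f u)"
            "4 * card {w \<in> level C f u. R w v} \<le> 3 * card (level C f u)"
          using exists_balanced_vertex by blast
        have vC: "v \<in> C" and lev: "level C f u = level C f v" using v by (auto simp: level_def)
        have "potential \<beta> s (N v) (split_levels R f v) \<le> potential \<beta> s C f - 1"
        proof (rule potential_drop_split[OF \<beta> s finC N_sub])
          show "s \<le> real (card (level C f v))" using large lev by simp
          fix w assume w: "w \<in> N v" "f w = f v"
          show "4 * card (level (N v) (split_levels R f v) w) \<le> 3 * card (level C f v)"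
          proof (cases "R v w")
            case True
            have "card (level (N v) (split_levels R f v) w) \<le> card {w \<in> level C f u. R v w}"
              by (rule card_mono) (use finC True w(2) lev in \<open>auto simp: level_def split_levels_eq_iff N_def\<close>)
            then show ?thesis using bal(1) lev by simp
          next
            case False
            have "level (N v) (split_levels R f v) w \<subseteq> {w \<in> level C f u. R w v}"
              using total[of _ v] False w(2) lev C vC by (auto simp: level_def split_levels_eq_iff N_def)
            then have "card (level (N v) (split_levels R f v) w) \<le> card {w \<in> level C f u. R w v}"
              using finC by (intro card_mono) (simp_all add: finite_level)
            then show ?thesis using bal(2) lev by simp
          qed
        qed (auto simp: split_levels_eq_iff)
        then show thesis using vC that by blast
      qed
    qed
    let ?p = "potential \<beta> s C f" and ?c = "real (card C)"
    have c: "1 \<le> ?c" using v finC by (auto simp: Suc_le_eq card_gt_0_iff)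
    have card_v: "card (C - {v}) = card C - 1" using v finC by simp
    have smaller: "card (C - {v}) < card C" "card (N v) < card C"
      using v finC by (auto simp only: N_def intro!: psubset_card_mono)
    \<comment> \<open>This makes the exponent \<open>?p - 1\<close> nonnegative, as the monotonicity
      of \<open>powr\<close> in the base requires.\<close>
    have p: "1 \<le> ?p"
      using drop potential_nonneg[OF \<beta> s0 finite_subset[OF N_sub finC], of v "split_levels R f v"] by simp
    have "real (card (transitive_sets R (C - {v}) f k)) \<le> (real (card (C - {v})) + 1) powr potential \<beta> s (C - {v}) f * ?B"
      using smaller(1) C k by (intro less.hyps) auto
    also have "real (card (C - {v})) + 1 = ?c" using card_v c by simp
    also have "?c powr potential \<beta> s (C - {v}) f \<le> ?c powr ?p"
      using c by (intro powr_mono potential_mono[OF \<beta> s0 finC]) auto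
    finally have 1: "real (card (transitive_sets R (C - {v}) f k)) \<le> ?c powr ?p * ?B"
      using mult_right_mono[OF _ B] by blast
    have "real (card (transitive_sets R (N v) (split_levels R f v) k'))
        \<le> (real (card (N v)) + 1) powr potential \<beta> s (N v) (split_levels R f v) * ?B"
      using smaller(2) C N_sub k k' by (intro less.hyps) auto
    also have "(real (card (N v)) + 1) powr potential \<beta> s (N v) (split_levels R f v)
        \<le> ?c powr potential \<beta> s (N v) (split_levels R f v)"
      using smaller(2) potential_nonneg[OF \<beta> s0 finite_subset[OF N_sub finC], of v "split_levels R f v"]
      by (intro powr_mono2) auto
    also have "\<dots> \<le> ?c powr (?p - 1)" using c drop by (intro powr_mono) auto
    finally have 2: "real (card (transitive_sets R (N v) (split_levels R f v) k')) \<le> ?c powr (?p - 1) * ?B"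
      using mult_right_mono[OF _ B] by blast
    have "real (card (transitive_sets R C f k))
        \<le> real (card (transitive_sets R (C - {v}) f k)) + real (card (transitive_sets R (N v) (split_levels R f v) k'))"
      using card_transitive_sets_branch[OF C v, of f k'] unfolding k' N_def
      by linarith
    also have "\<dots> \<le> (?c powr ?p + ?c powr (?p - 1)) * ?B"
      using add_mono[OF 1 2] by (simp only: distrib_right)
    \<comment> \<open>With \<open>c = card C\<close> and \<open>p\<close> the potential, the
      recursion closes because \<open>c powr p + c powr (p - 1) = (c + 1) * c powr (p - 1)\<close>,
      at most \<open>(c + 1) powr p\<close>.\<close>
    also have "?c powr ?p = ?c * ?c powr (?p - 1)" using c by (simp add: powr_diff)
    also have "(?c * ?c powr (?p - 1) + ?c powr (?p - 1)) * ?B = (?c + 1) * ?c powr (?p - 1) * ?B"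
      by (simp only: distrib_right mult_1_left)
    also have "\<dots> \<le> (?c + 1) * (?c + 1) powr (?p - 1) * ?B"
      using c p B by (intro mult_right_mono mult_left_mono powr_mono2) auto
    also have "(?c + 1) * (?c + 1) powr (?p - 1) = (?c + 1) powr ?p" using c by (simp add: powr_diff)
    finally show ?thesis .
  qed
qed

end

subsection \<open>Orderings of a set with sparse levels\<close>

lemma sum_UN_le:
  fixes h :: "'b \<Rightarrow> real"
  assumes "finite A" "\<And>a. a \<in> A \<Longrightarrow> finite (B a)" "\<And>x. 0 \<le> h x"
  shows "sum h (\<Union>a\<in>A. B a) \<le> (\<Sum>a\<in>A. sum h (B a))"
  using assms(1,2)
proof (induction A rule: finite_induct)
  case (insert a A)
  have "sum h (B a \<union> (\<Union>a\<in>A. B a)) \<le> sum h (B a) + sum h (\<Union>a\<in>A. B a)"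
    using insert by (subst sum_Un) (auto intro!: sum_nonneg assms(3))
  then show ?case using insert by simp
qed simp

text \<open>Vertices are grouped by the number of vertices strictly below them, in steps of
  \<open>s\<close>. In one block these numbers differ by less than \<open>s\<close>, and the top
  level of the block adds at most \<open>s\<close> more.\<close>

lemma merge_levels:
  assumes C: "finite C" and s: "0 < s" and level: "\<And>v. v \<in> C \<Longrightarrow> real (card (level C f v)) \<le> s"
  shows "\<exists>g. (\<forall>u v. f u \<le> f v \<longrightarrow> g u \<le> g v) \<and> real (card (g ` C)) \<le> real (card C) / s + 1
    \<and> (\<forall>v\<in>C. real (card (level C g v)) \<le> 2 * s)"
proof -
  define F where "F v = card {u \<in> C. f u < f v}" for v
  define g where "g v = nat \<lfloor>real (F v) / s\<rfloor>" for v
  have F_mono: "F u \<le> F v" if "f u \<le> f v" for u v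
    unfolding F_def by (rule card_mono) (use C that in auto)
  have g_mono: "g u \<le> g v" if "f u \<le> f v" for u v
    unfolding g_def using F_mono[OF that] s by (intro nat_mono floor_mono divide_right_mono) auto
  have F_le: "F v \<le> card C" for v
    unfolding F_def by (rule card_mono) (use C in auto)
  have "g ` C \<subseteq> {..nat \<lfloor>real (card C) / s\<rfloor>}"
  proof (intro image_subsetI, unfold atMost_iff g_def)
    fix v show "nat \<lfloor>real (F v) / s\<rfloor> \<le> nat \<lfloor>real (card C) / s\<rfloor>"
      using F_le[of v] s by (intro nat_mono floor_mono divide_right_mono) auto
  qed
  then have "card (g ` C) \<le> card {..nat \<lfloor>real (card C) / s\<rfloor>}" by (intro card_mono) auto
  then have "real (card (g ` C)) \<le> real (nat \<lfloor>real (card C) / s\<rfloor>) + 1" by simp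
  also have "real (nat \<lfloor>real (card C) / s\<rfloor>) \<le> real (card C) / s" using s by (intro of_nat_floor) simp
  finally have image: "real (card (g ` C)) \<le> real (card C) / s + 1" by simp
  have "real (card (level C g v)) \<le> 2 * s" if v: "v \<in> C" for v
  proof -
    let ?L = "level C g v"
    have L: "finite (f ` ?L)" "f ` ?L \<noteq> {}" using C v by (auto simp: level_def)
    obtain x where x: "x \<in> ?L" "f x = Min (f ` ?L)" using Min_in[OF L] by auto
    obtain y where y: "y \<in> ?L" "f y = Max (f ` ?L)" using Max_in[OF L] by auto
    have between: "f x \<le> f u \<and> f u \<le> f y" if "u \<in> ?L" for u
      using Min_le[OF L(1)] Max_ge[OF L(1)] x(2) y(2) that by simp
    have xy: "x \<in> C" "y \<in> C" "g x = g y" using x(1) y(1) by (auto simp: level_def)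
    have sub: "{u \<in> C. f u < f x} \<subseteq> {u \<in> C. f u < f y}" using between[OF y(1)] by auto
    \<comment> \<open>\<open>x\<close> and \<open>y\<close> lie in the lowest and highest level of
      the block; \<open>F y - F x\<close> counts the vertices from the level of \<open>x\<close> up
      to just below that of \<open>y\<close>.\<close>
    have "?L \<subseteq> ({u \<in> C. f u < f y} - {u \<in> C. f u < f x}) \<union> level C f y"
    proof
      fix u assume u: "u \<in> ?L"
      then have "u \<in> C" by (simp add: level_def)
      then show "u \<in> ({u \<in> C. f u < f y} - {u \<in> C. f u < f x}) \<union> level C f y"
        using between[OF u] by (auto simp: level_def)
    qed
    then have "card ?L \<le> card (({u \<in> C. f u < f y} - {u \<in> C. f u < f x}) \<union> level C f y)"
      using C by (intro card_mono) (auto simp: level_def)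
    also have "\<dots> \<le> card ({u \<in> C. f u < f y} - {u \<in> C. f u < f x}) + card (level C f y)"
      by (rule card_Un_le)
    also have "card ({u \<in> C. f u < f y} - {u \<in> C. f u < f x}) = F y - F x"
      unfolding F_def using C sub by (intro card_Diff_subset) auto
    finally have "real (card ?L) \<le> real (F y) - real (F x) + s"
      using level[OF xy(2)] F_mono[of x y] between[OF y(1)] by linarith
    moreover have "real (F y) / s < real (F x) / s + 1"
    proof -
      have nonneg: "0 \<le> \<lfloor>real (F u) / s\<rfloor>" for u using s by simp
      have "\<lfloor>real (F x) / s\<rfloor> = \<lfloor>real (F y) / s\<rfloor>"
        using xy(3) eq_nat_nat_iff[OF nonneg nonneg] unfolding g_def by blast
      then show ?thesis by linarith
    qed
    then have "real (F y) < real (F x) + s" using s by (simp add: field_simps)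
    ultimately show ?thesis by linarith
  qed
  with g_mono image show ?thesis by blast
qed

context tournament_relation
begin

text \<open>First moment bound: for a prescribed set of size \<open>D\<close>, the expected number
  of backward \<open>t\<close>-subsets is at most \<open>(D choose t) / t!\<close>, hence at most
  \<open>(exp 2 * D / t^2) ^ t\<close>. For \<open>t\<close> as chosen this is at most
  \<open>exp (- L)\<close>, and there are fewer than \<open>exp L\<close> prescribed sets.\<close>

lemma exists_ordering_sparse_backward:
  assumes W: "finite \<W>" "\<W> \<subseteq> Pow V"
    and L: "1 \<le> L" "real (card \<W>) < exp L"
  shows "\<exists>g. inj_on g V \<and> g ` V \<subseteq> {..<card V} \<and>
    (\<forall>W\<in>\<W>. \<forall>U\<subseteq>W. backward R g U \<longrightarrow> real (card U) \<le> exp 2 * L * sqrt (real (card W)))"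
proof -
  define t where "t W = nat \<lceil>exp 2 * L * sqrt (real (card W))\<rceil>" for W :: "'a set"
  define B where "B W = {U. U \<subseteq> W \<and> card U = t W}" for W
  \<comment> \<open>The empty set is left out: it would have \<open>t = 0\<close>, and the empty
    subset alone would contribute 1 to the sum. The claim is trivial for it.\<close>
  define A where "A = \<W> - {{}}"
  have finW: "finite W" if "W \<in> \<W>" for W using that W(2) finite_V finite_subset by blast
  have finB: "finite (B W)" if "W \<in> \<W>" for W using finW[OF that] by (simp add: B_def)
  have finA: "finite A" using W(1) by (simp add: A_def)
  have each: "(\<Sum>U\<in>B W. 1 / fact (card U)) \<le> exp (- L)" if "W \<in> A" for W
  proof -
    let ?D = "real (card W)" and ?t = "t W"
    have fW: "finite W" and ne: "W \<noteq> {}" using that finW by (auto simp: A_def)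
    have D: "1 \<le> ?D" using fW ne by (simp add: Suc_le_eq card_gt_0_iff)
    have t_ge: "exp 2 * L * sqrt ?D \<le> real ?t" unfolding t_def by linarith
    have "L \<le> exp 2 * L" using L(1) by simp
    also have "\<dots> \<le> exp 2 * L * sqrt ?D" using L(1) D by simp
    finally have t: "L \<le> real ?t" using t_ge by simp
    then have t0: "0 < real ?t" using L(1) by linarith
    have "exp 2 * sqrt ?D \<le> exp 2 * L * sqrt ?D" using L(1) D by simp
    then have "exp 2 * sqrt ?D \<le> real ?t" using t_ge by (rule order_trans)
    then have "(exp 2 * sqrt ?D)\<^sup>2 \<le> (real ?t)\<^sup>2" by (intro power_mono) auto
    then have sq: "exp 4 * ?D \<le> (real ?t)\<^sup>2" using D by (simp add: power_mult_distrib flip: exp_double)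
    have "(\<Sum>U\<in>B W. 1 / fact (card U)) = real (card (B W)) / fact ?t" by (simp add: B_def)
    also have "\<dots> = real (card W choose ?t) / fact ?t" by (simp add: B_def n_subsets[OF fW])
    also have "\<dots> \<le> ?D ^ ?t / fact ?t / fact ?t"
      by (intro divide_right_mono binomial_le_power_divide_fact) simp
    also have "\<dots> = ?D ^ ?t * (1 / fact ?t)\<^sup>2" by (simp add: power2_eq_square)
    also have "\<dots> \<le> ?D ^ ?t * (exp (real ?t) / real ?t ^ ?t)\<^sup>2"
    proof (intro mult_left_mono power_mono)
      show "1 / fact ?t \<le> exp (real ?t) / real ?t ^ ?t"
        using power_self_le_exp_fact[of ?t] t0 by (simp add: field_simps)
    qed simp_all
    also have "exp (real ?t) / real ?t ^ ?t = (exp 1 / real ?t) ^ ?t"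
      using exp_of_nat_mult[of ?t "1 :: real"] by (simp add: power_divide)
    also have "((exp 1 / real ?t) ^ ?t)\<^sup>2 = ((exp 1 / real ?t)\<^sup>2) ^ ?t"
      by (simp only: power_mult[symmetric] mult.commute)
    also have "?D ^ ?t * \<dots> = (?D * (exp 1 / real ?t)\<^sup>2) ^ ?t"
      by (rule power_mult_distrib[symmetric])
    also have "\<dots> \<le> exp (- 2) ^ ?t"
    proof (intro power_mono)
      have "?D * (exp 1 / real ?t)\<^sup>2 * exp 2 = exp 4 * ?D / (real ?t)\<^sup>2"
        using exp_double[of "1 :: real"] exp_add[of 2 "2 :: real"] by (simp add: power_divide)
      also have "\<dots> \<le> 1" using sq t0 by simp
      finally show "?D * (exp 1 / real ?t)\<^sup>2 \<le> exp (- 2)" by (simp add: exp_minus field_simps)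
    qed simp
    also have "\<dots> = exp (- 2 * real ?t)" by (simp add: exp_of_nat_mult[symmetric] mult.commute)
    also have "\<dots> \<le> exp (- L)" using t t0 by simp
    finally show ?thesis .
  qed
  have "(\<Sum>U\<in>(\<Union>W\<in>A. B W). 1 / fact (card U)) \<le> (\<Sum>W\<in>A. \<Sum>U\<in>B W. 1 / fact (card U) :: real)"
    using finA finB by (intro sum_UN_le) (auto simp: A_def)
  also have "\<dots> \<le> (\<Sum>W\<in>A. exp (- L))" using each by (rule sum_mono)
  also have "\<dots> \<le> real (card \<W>) * exp (- L)" using W(1) by (simp add: A_def card_Diff1_le)
  also have "\<dots> < 1" using L(2) by (simp add: exp_minus field_simps)
  finally have sum: "(\<Sum>U\<in>(\<Union>W\<in>A. B W). 1 / fact (card U)) < (1 :: real)" .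
  have sub: "(\<Union>W\<in>A. B W) \<subseteq> Pow V" using W(2) by (auto simp: A_def B_def)
  from exists_ordering_avoiding[OF sub sum] obtain g where g: "inj_on g V" "g ` V \<subseteq> {..<card V}"
    and avoid: "\<forall>U\<in>(\<Union>W\<in>A. B W). \<not> backward R g U"
    by (elim exE conjE)
  have "real (card U) \<le> exp 2 * L * sqrt (real (card W))"
    if W: "W \<in> \<W>" and U: "U \<subseteq> W" "backward R g U" for W U
  proof (rule ccontr)
    assume large: "\<not> ?thesis"
    then have "t W \<le> card U" unfolding t_def by linarith
    then obtain U' where U': "U' \<subseteq> U" "card U' = t W" using obtain_subset_with_card_n by metis
    have "W \<noteq> {}" using large U(1) by auto
    then have "W \<in> A" "U' \<in> B W" using W U' U(1) by (auto simp: A_def B_def)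
    then have "U' \<in> (\<Union>W\<in>A. B W)" by blast
    then show False using avoid backward_subset[OF U(2) U'(1)] by blast
  qed
  with g show ?thesis by blast
qed

text \<open>Order by level first and randomly inside each level. If \<open>v\<close> lies in a backward set \<open>I\<close>, then
  the part of \<open>I\<close> in another level consists of conflicts of \<open>v\<close>, so that it is a backward subset of one of
  few prescribed sets. The Cauchy-Schwarz inequality sums the square roots over the levels.\<close>

lemma exists_ordering_of_levels:
  assumes ne: "V \<noteq> {}" and s: "0 \<le> s" and D: "0 \<le> D"
    and level: "\<And>v. v \<in> V \<Longrightarrow> real (card (level V f v)) \<le> s"
    and conf: "\<And>v. v \<in> V \<Longrightarrow> real (card (conflicts R V f v)) \<le> D"
  shows "\<exists>g. inj_on g V \<and> (\<forall>I\<subseteq>V. backward R g I \<longrightarrow>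
    real (card I) \<le> 2 * exp 2 * ln (real (card V) + 1) * (sqrt s + sqrt (D * real (card (f ` V)))))"
proof -
  let ?n = "card V"
  define W where "W v j = {w \<in> V. f w = j \<and> (j = f v \<or> w \<in> conflicts R V f v)}" for v j
  define \<W> where "\<W> = (\<lambda>(v, j). W v j) ` (V \<times> f ` V)"
  \<comment> \<open>With this choice \<open>exp L\<close> is \<open>(n + 1)^2\<close> for
    \<open>n = card V\<close>, more than the number of pairs of a vertex and a level.\<close>
  define L where "L = 2 * ln (real ?n + 1)"
  have n: "1 \<le> real ?n" using ne finite_V by (simp add: Suc_le_eq card_gt_0_iff)
  have "1 / 2 \<le> ln (real ?n + 1)" using n by (intro half_le_ln_Suc) simp
  then have L1: "1 \<le> L" by (simp add: L_def)
  have fin: "finite \<W>" using finite_V by (simp add: \<W>_def)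
  have "card \<W> \<le> card (V \<times> f ` V)" unfolding \<W>_def using finite_V by (intro card_image_le) simp
  also have "\<dots> \<le> ?n * ?n" using card_image_le[OF finite_V, of f] by (simp add: card_cartesian_product)
  finally have "real (card \<W>) \<le> real (?n * ?n)" by (simp only: of_nat_le_iff)
  also have "\<dots> < (real ?n + 1)\<^sup>2" by (simp add: power2_eq_square algebra_simps)
  also have "\<dots> = exp L" using n by (simp add: L_def exp_double)
  finally have card_L: "real (card \<W>) < exp L" .
  have sub: "\<W> \<subseteq> Pow V" by (auto simp: \<W>_def W_def)
  from exists_ordering_sparse_backward[OF fin sub L1 card_L]
  obtain h where h: "inj_on h V" "h ` V \<subseteq> {..<?n}"
    and sparse: "\<forall>X\<in>\<W>. \<forall>U\<subseteq>X. backward R h U \<longrightarrow> real (card U) \<le> exp 2 * L * sqrt (real (card X))"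
    by (elim exE conjE)
  \<comment> \<open>Lexicographic order: \<open>h\<close> stays below \<open>card V\<close>, so the
    level decides first.\<close>
  define g where "g w = f w * ?n + h w" for w
  have g_less: "g u < g w" if "u \<in> V" "f u < f w" for u w
  proof -
    have "h u < ?n" using h(2) that(1) by auto
    then have "g u < Suc (f u) * ?n" by (simp add: g_def)
    also have "\<dots> \<le> f w * ?n" using that(2) by (intro mult_right_mono) auto
    finally show ?thesis by (simp add: g_def)
  qed
  have "inj_on g V"
  proof (rule inj_onI)
    fix u w assume "u \<in> V" "w \<in> V" "g u = g w"
    then have "f u = f w" using g_less[of u w] g_less[of w u] by linarith
    then show "u = w" using \<open>g u = g w\<close> h(1) \<open>u \<in> V\<close> \<open>w \<in> V\<close> by (auto simp: g_def inj_on_def)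
  qed
  moreover have "real (card I) \<le> exp 2 * L * (sqrt s + sqrt (D * real (card (f ` V))))"
    if I: "I \<subseteq> V" "backward R g I" for I
  proof (cases "I = {}")
    case True
    then show ?thesis using L1 s D by simp
  next
    case False
    then obtain v where v: "v \<in> I" by blast
    then have vV: "v \<in> V" using I(1) by blast
    have finI: "finite I" using I(1) finite_V finite_subset by blast
    have part: "real (card {w \<in> I. f w = j}) \<le> exp 2 * L * sqrt (real (card (W v j)))" if j: "j \<in> f ` V" for j
    proof (rule sparse[rule_format])
      show "W v j \<in> \<W>" using vV j by (auto simp: \<W>_def)
      show "backward R h {w \<in> I. f w = j}"
        unfolding backward_def
      proof (intro ballI impI)
        fix x y assume xy: "x \<in> {w \<in> I. f w = j}" "y \<in> {w \<in> I. f w = j}" "R x y"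
        then have "g y < g x" using I(2) by (simp add: backward_def)
        then show "h y < h x" using xy by (simp add: g_def)
      qed
      show "{w \<in> I. f w = j} \<subseteq> W v j"
      proof
        fix w assume "w \<in> {w \<in> I. f w = j}"
        then have w: "w \<in> I" "f w = j" by auto
        then have wV: "w \<in> V" using I(1) by blast
        have "w \<in> conflicts R V f v" if ne: "f w \<noteq> f v"
        proof (cases "f w < f v")
          case True
          then have "\<not> R w v" using g_less[OF wV True] I(2) v w(1) unfolding backward_def by (meson less_asym)
          then show ?thesis using total[OF wV vV] ne True wV by (auto simp: conflicts_def)
        next
          case False
          then have less: "f v < f w" using ne by simp
          then have "\<not> R v w" using g_less[OF vV less] I(2) v w(1) unfolding backward_def by (meson less_asym)
          then show ?thesis using total[OF wV vV] ne less wV by (auto simp: conflicts_def)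
        qed
        then show "w \<in> W v j" using w wV by (auto simp: W_def)
      qed
    qed
    let ?J = "f ` V - {f v}"
    have "(\<Sum>j\<in>?J. card (W v j)) = card (\<Union>j\<in>?J. W v j)"
      using finite_V by (intro card_UN_disjoint[symmetric]) (auto simp: W_def)
    also have "\<dots> \<le> card (conflicts R V f v)"
      using finite_V by (intro card_mono) (auto simp: W_def conflicts_def)
    finally have "(\<Sum>j\<in>?J. real (card (W v j))) \<le> D"
      using conf[OF vV] by (simp flip: of_nat_sum)
    moreover have "real (card ?J) \<le> real (card (f ` V))" using finite_V by (simp add: card_mono)
    ultimately have "(\<Sum>j\<in>?J. real (card (W v j))) * real (card ?J) \<le> D * real (card (f ` V))"
      using D by (intro mult_mono) auto
    moreover have "(\<Sum>j\<in>?J. sqrt (real (card (W v j))))\<^sup>2 \<le> (\<Sum>j\<in>?J. real (card (W v j))) * real (card ?J)"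
      using sum_squared_le_sum_of_squares[of "\<lambda>j. sqrt (real (card (W v j)))" ?J] by simp
    ultimately have off: "(\<Sum>j\<in>?J. sqrt (real (card (W v j)))) \<le> sqrt (D * real (card (f ` V)))"
      by (intro real_le_rsqrt) linarith
    have "W v (f v) = level V f v" by (auto simp: W_def level_def)
    then have own: "sqrt (real (card (W v (f v)))) \<le> sqrt s" using level[OF vV] by simp
    have "real (card I) = (\<Sum>j\<in>f ` V. real (card {w \<in> I. f w = j}))"
      using sum.group[OF finI finite_imageI[OF finite_V, of f], of f "\<lambda>_. 1 :: real"] I(1)
      by (simp add: image_mono)
    also have "\<dots> \<le> (\<Sum>j\<in>f ` V. exp 2 * L * sqrt (real (card (W v j))))" using part by (rule sum_mono)
    also have "\<dots> = exp 2 * L * (\<Sum>j\<in>f ` V. sqrt (real (card (W v j))))" by (rule sum_distrib_left[symmetric])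
    also have "(\<Sum>j\<in>f ` V. sqrt (real (card (W v j))))
        = sqrt (real (card (W v (f v)))) + (\<Sum>j\<in>?J. sqrt (real (card (W v j))))"
      using finite_V vV by (intro sum.remove) auto
    also have "exp 2 * L * \<dots> \<le> exp 2 * L * (sqrt s + sqrt (D * real (card (f ` V))))"
      using L1 by (intro mult_left_mono[OF add_mono[OF own off]]) simp
    finally show ?thesis .
  qed
  ultimately show ?thesis by (auto simp: L_def mult_ac)
qed

text \<open>Merging levels monotonically creates no conflicts, so the bound \<open>D\<close>
  survives while the number of levels falls to about \<open>card V / s\<close>.\<close>

lemma exists_ordering_of_merged_levels:
  assumes ne: "V \<noteq> {}" and s: "0 < s" and D: "0 \<le> D"
    and level: "\<And>v. v \<in> V \<Longrightarrow> real (card (level V f v)) \<le> s"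
    and conf: "\<And>v. v \<in> V \<Longrightarrow> real (card (conflicts R V f v)) \<le> D"
  shows "\<exists>g. inj_on g V \<and> (\<forall>I\<subseteq>V. backward R g I \<longrightarrow>
    real (card I) \<le> 2 * exp 2 * ln (real (card V) + 1) * (sqrt (2 * s) + sqrt (D * (real (card V) / s + 1))))"
proof -
  obtain f' where mono: "\<And>u v. f u \<le> f v \<Longrightarrow> f' u \<le> f' v"
    and image: "real (card (f' ` V)) \<le> real (card V) / s + 1"
    and level': "\<And>v. v \<in> V \<Longrightarrow> real (card (level V f' v)) \<le> 2 * s"
    using merge_levels[OF finite_V s level] by blast
  have less: "f u < f v" if "f' u < f' v" for u v using mono[of v u] that by linarith
  have conf': "real (card (conflicts R V f' v)) \<le> D" if "v \<in> V" for v
  proof -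
    have "card (conflicts R V f' v) \<le> card (conflicts R V f v)"
      using finite_V less by (intro card_mono) (auto simp: conflicts_def)
    then show ?thesis using conf[OF that] by linarith
  qed
  obtain g where "inj_on g V"
    and g: "\<And>I. I \<subseteq> V \<Longrightarrow> backward R g I \<Longrightarrow>
      real (card I) \<le> 2 * exp 2 * ln (real (card V) + 1) * (sqrt (2 * s) + sqrt (D * real (card (f' ` V))))"
    using exists_ordering_of_levels[OF ne _ D level' conf'] s by auto
  moreover have "2 * exp 2 * ln (real (card V) + 1) * (sqrt (2 * s) + sqrt (D * real (card (f' ` V))))
      \<le> 2 * exp 2 * ln (real (card V) + 1) * (sqrt (2 * s) + sqrt (D * (real (card V) / s + 1)))"
    using image D by (intro mult_left_mono add_left_mono real_sqrt_le_mono) auto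
  ultimately show ?thesis by (meson order_trans)
qed

end

subsection \<open>The two cases\<close>

text \<open>Here \<open>X\<close> stands for the ninth root of the number of vertices,
  \<open>c\<close> for the size of the container and \<open>8 * X ^ 6 * L^2\<close> for the level
  size \<open>s\<close>. Both roots are compared with \<open>c * L / X ^ 5\<close>.\<close>

lemma sum_sqrt_le:
  fixes X L m c :: real
  assumes X: "1 \<le> X" and L: "1 / 2 \<le> L" and m: "X ^ 4 \<le> m" and c: "1 \<le> c" and cX: "X ^ 8 \<le> 28 * c"
  shows "sqrt (2 * (8 * X ^ 6 * L\<^sup>2)) + sqrt (2 * L\<^sup>2 / m * (c + 1) * (c / (8 * X ^ 6 * L\<^sup>2) + 1))
    \<le> 123 * (c * L / X ^ 5)"
proof -
  define B where "B = c * L / X ^ 5"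
  have B0: "0 \<le> B" using L X c by (simp add: B_def)
  have X0: "0 < X" and L0: "0 < L" and c0: "0 < c" using X L c by linarith+
  have "0 < X ^ 4" using X0 by simp
  then have m0: "0 < m" using m by linarith
  have "(1/2)\<^sup>2 \<le> L\<^sup>2" using L by (intro power_mono) auto
  then have L2: "1 \<le> 4 * L\<^sup>2" by (simp add: power2_eq_square)
  have "sqrt (2 * (8 * X ^ 6 * L\<^sup>2)) = sqrt ((4 * X ^ 3 * L)\<^sup>2)"
    by (simp add: power_mult_distrib flip: power_mult)
  also have "\<dots> = 4 * X ^ 3 * L" using X0 L0 by simp
  also have "X ^ 3 = X ^ 8 / X ^ 5" using power_diff[of X 5 8] X0 by simp
  also have "4 * (X ^ 8 / X ^ 5) * L = 4 * L * X ^ 8 / X ^ 5" by simp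
  also have "\<dots> \<le> 4 * L * (28 * c) / X ^ 5"
    using cX X0 L0 by (intro divide_right_mono mult_left_mono) auto
  also have "\<dots> = 112 * B" by (simp add: B_def)
  finally have 1: "sqrt (2 * (8 * X ^ 6 * L\<^sup>2)) \<le> 112 * B" .
  have "2 * L\<^sup>2 / m * (c + 1) \<le> 2 * L\<^sup>2 / X ^ 4 * (2 * c)"
    using m X0 m0 c by (intro mult_mono divide_left_mono) auto
  then have "2 * L\<^sup>2 / m * (c + 1) * (c / (8 * X ^ 6 * L\<^sup>2) + 1)
      \<le> 2 * L\<^sup>2 / X ^ 4 * (2 * c) * (c / (8 * X ^ 6 * L\<^sup>2) + 1)"
    using X0 c0 by (intro mult_right_mono) auto
  also have "\<dots> = c\<^sup>2 / (2 * X ^ 10) * 1 + 4 * L\<^sup>2 * c / X ^ 4 * 1"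
  proof -
    have "2 * L\<^sup>2 / Y * (2 * c) * (c / (8 * Z * L\<^sup>2) + 1) = c\<^sup>2 / (2 * (Y * Z)) * 1 + 4 * L\<^sup>2 * c / Y * 1"
      if "0 < Y" "0 < Z" for Y Z :: real
      using that L0 by (simp add: field_simps power2_eq_square)
    from this[of "X ^ 4" "X ^ 6"] show ?thesis using X0 by (simp flip: power_add)
  qed
  \<comment> \<open>Factors at least 1, namely \<open>4 * L^2\<close> and
    \<open>28 * c / X ^ 8\<close>, are inserted to bring both terms to multiples of the square of
    \<open>B\<close>.\<close>
  also have "\<dots> \<le> c\<^sup>2 / (2 * X ^ 10) * (4 * L\<^sup>2) + 4 * L\<^sup>2 * c / X ^ 4 * (28 * c / X ^ 8)"
    using L2 c0 X0 cX by (intro add_mono mult_left_mono) auto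
  also have "c\<^sup>2 / (2 * X ^ 10) * (4 * L\<^sup>2) = 2 * B\<^sup>2"
    by (simp add: B_def power_divide power_mult_distrib flip: power_mult)
  also have "4 * L\<^sup>2 * c / X ^ 4 * (28 * c / X ^ 8) = 112 * (c * L)\<^sup>2 / X ^ 12"
    by (simp add: power_mult_distrib power2_eq_square flip: power_add)
  also have "\<dots> \<le> 112 * (c * L)\<^sup>2 / X ^ 10"
    using X X0 by (intro divide_left_mono power_increasing) auto
  also have "\<dots> = 112 * B\<^sup>2" by (simp add: B_def power_divide flip: power_mult)
  also have "2 * B\<^sup>2 + 112 * B\<^sup>2 \<le> (11 * B)\<^sup>2" by (simp add: power_mult_distrib)
  finally have "2 * L\<^sup>2 / m * (c + 1) * (c / (8 * X ^ 6 * L\<^sup>2) + 1) \<le> (11 * B)\<^sup>2" by simp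
  then have 2: "sqrt (2 * L\<^sup>2 / m * (c + 1) * (c / (8 * X ^ 6 * L\<^sup>2) + 1)) \<le> 11 * B"
    using B0 by (intro real_le_lsqrt) simp_all
  show ?thesis unfolding B_def[symmetric] using 1 2 by linarith
qed

context tournament_relation
begin

text \<open>In a backward set the arcs are exactly the descending pairs, so transitivity is
  inherited from the order of the naturals.\<close>

lemma backward_in_transitive_sets:
  assumes "U \<subseteq> V" "backward R g U"
  shows "U \<in> transitive_sets R V (\<lambda>_. 0) (card U)"
proof -
  have "transp_on U R"
  proof (rule transp_onI)
    fix x y z assume U: "x \<in> U" "y \<in> U" "z \<in> U" and "R x y" "R y z"
    then have "g z < g x" using assms(2) unfolding backward_def by (meson less_trans)
    then show "R x z" using backward_less_iff[OF assms U(3,1)] by simp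
  qed
  then show ?thesis using assms(1) by (simp add: transitive_sets_def)
qed

text \<open>Union bound over the transitive \<open>m\<close>-sets, each backward with probability at
  most \<open>1 / fact m\<close>; a larger backward set would contain a backward
  \<open>m\<close>-set.\<close>

lemma exists_ordering_of_few_transitive_sets:
  assumes "card (transitive_sets R V (\<lambda>_. 0) m) < fact m"
  shows "\<exists>g. inj_on g V \<and> (\<forall>I\<subseteq>V. backward R g I \<longrightarrow> card I < m)"
proof -
  let ?F = "transitive_sets R V (\<lambda>_. 0) m"
  have F: "?F \<subseteq> Pow V" by (auto simp: transitive_sets_def)
  have "(\<Sum>U\<in>?F. 1 / fact (card U)) = (\<Sum>U\<in>?F. 1 / fact m :: real)"
    by (rule sum.cong) (auto simp: transitive_sets_def)
  also have "\<dots> = real (card ?F) / fact m" by simp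
  also have "\<dots> < 1"
  proof -
    have "real (card ?F) < real (fact m)" using assms by (simp only: of_nat_less_iff)
    then show ?thesis by simp
  qed
  finally have sum: "(\<Sum>U\<in>?F. 1 / fact (card U)) < (1 :: real)" .
  from exists_ordering_avoiding[OF F sum] obtain g where g: "inj_on g V"
    and avoid: "\<forall>U\<in>?F. \<not> backward R g U"
    by (elim exE conjE)
  have "card I < m" if I: "I \<subseteq> V" "backward R g I" for I
  proof (rule ccontr)
    assume "\<not> card I < m"
    then obtain U where U: "U \<subseteq> I" "card U = m" by (meson not_less obtain_subset_with_card_n)
    have "backward R g U" using I(2) U(1) by (rule backward_subset)
    moreover from this have "U \<in> ?F" using backward_in_transitive_sets[of U g] U I(1) by blast
    ultimately show False using avoid by blast
  qed
  with g show ?thesis by blast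
qed

text \<open>If no container existed, the count of transitive sets would give
  \<open>(fact m)^2 \<le> exp m * (m^2 / 28) ^ m\<close>. Together with
  \<open>m ^ m \<le> exp m * fact m\<close> this yields \<open>28 ^ m \<le> exp (3 * m)\<close>,
  which fails since \<open>exp 3 < 28\<close>.\<close>

lemma exists_sparse_levels:
  assumes ne: "V \<noteq> {}" and m: "28 \<le> m" and many: "fact m \<le> card (transitive_sets R V (\<lambda>_. 0) m)"
    and L: "L = ln (real (card V) + 1)" and s: "1 < s" "8 * real (card V) * L\<^sup>2 / real m \<le> s"
  shows "\<exists>C f. C \<subseteq> V \<and> (real m)\<^sup>2 / 28 \<le> real (card C) \<and>
    (\<forall>v\<in>C. real (card (conflicts R C f v)) \<le> 2 * L\<^sup>2 / real m * (real (card C) + 1)) \<and>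
    (\<forall>v\<in>C. real (card (level C f v)) \<le> s)"
proof (rule ccontr)
  assume none: "\<not> ?thesis"
  let ?n = "real (card V)" and ?M = "(real m)\<^sup>2 / 28" and ?\<beta> = "2 * L\<^sup>2 / real m"
  let ?P = "potential ?\<beta> s V (\<lambda>_. 0)"
  have n: "1 \<le> card V" using ne finite_V by (simp add: Suc_le_eq card_gt_0_iff)
  have L0: "1/2 \<le> L" using half_le_ln_Suc[OF n] L by simp
  have \<beta>: "0 < ?\<beta>" using L0 m by simp
  have M: "0 < ?M" "real m \<le> ?M" using m by (auto simp: power2_eq_square)
  have bad: "(\<exists>v\<in>C. ?\<beta> * (real (card C) + 1) \<le> real (card (conflicts R C f v))) \<or>
      (\<exists>v\<in>C. s \<le> real (card (level C f v)))" if "C \<subseteq> V" "?M \<le> real (card C)" for C f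
    using none that by (meson linear)
  have "real (card (transitive_sets R V (\<lambda>_. 0) m)) \<le> (?n + 1) powr ?P * (?M ^ m / fact m)"
    by (rule card_transitive_sets_bound[OF \<beta> s(1) M bad]) simp_all
  moreover have "real (fact m) \<le> real (card (transitive_sets R V (\<lambda>_. 0) m))"
    using many by (simp only: of_nat_le_iff)
  then have "fact m \<le> real (card (transitive_sets R V (\<lambda>_. 0) m))" by simp
  ultimately have "fact m \<le> (?n + 1) powr ?P * (?M ^ m / fact m)" by linarith
  then have fact2: "(fact m)\<^sup>2 \<le> (?n + 1) powr ?P * ?M ^ m" by (simp add: field_simps power2_eq_square)
  \<comment> \<open>The conflict threshold and the lower bound on \<open>s\<close> are chosen so
    that each summand of the potential is at most \<open>m / (2 * L)\<close>. The number of query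
    patterns is then at most \<open>exp m\<close>.\<close>
  have "?P \<le> real m / L"
  proof -
    have "(\<Sum>w\<in>V. ln (real (card (level V (\<lambda>_. 0) w)))) \<le> (\<Sum>w\<in>V. L)"
    proof (rule sum_mono)
      fix w show "ln (real (card (level V (\<lambda>_. 0) w))) \<le> L"
        unfolding L level_def using n by (simp add: ln_mono)
    qed
    then have sum: "(\<Sum>w\<in>V. ln (real (card (level V (\<lambda>_. 0) w)))) \<le> ?n * L" by simp
    have "4 / s * (\<Sum>w\<in>V. ln (real (card (level V (\<lambda>_. 0) w)))) \<le> 4 / s * (?n * L)"
      using sum s(1) by (intro mult_left_mono) auto
    also have "\<dots> = real m / (2 * L) * ((8 * ?n * L\<^sup>2 / real m) / s)"
      using L0 m s(1) by (simp add: field_simps power2_eq_square)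
    also have "\<dots> \<le> real m / (2 * L) * 1"
    proof (intro mult_left_mono)
      show "8 * ?n * L\<^sup>2 / real m / s \<le> 1"
        using s by (subst divide_le_eq_1_pos) linarith+
    qed (use L0 in simp)
    finally have "4 / s * (\<Sum>w\<in>V. ln (real (card (level V (\<lambda>_. 0) w)))) \<le> real m / (2 * L)" by simp
    moreover have "ln (?n + 1) / ?\<beta> = real m / (2 * L)"
      using L0 m unfolding L[symmetric] by (simp add: field_simps power2_eq_square)
    moreover have "real m / L = real m / (2 * L) + real m / (2 * L)" using L0 by (simp add: field_simps)
    ultimately show ?thesis unfolding potential_def by linarith
  qed
  then have "(?n + 1) powr ?P \<le> (?n + 1) powr (real m / L)" by (intro powr_mono) auto
  also have "\<dots> = exp (real m)" using L0 unfolding powr_def L[symmetric] by simp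
  finally have "(fact m)\<^sup>2 \<le> exp (real m) * ?M ^ m"
    using fact2 M(1) by (meson order_trans mult_right_mono zero_le_power less_imp_le)
  moreover have "(real m ^ m)\<^sup>2 \<le> (exp (real m) * fact m)\<^sup>2"
    by (intro power_mono power_self_le_exp_fact) simp
  ultimately have "(real m ^ m)\<^sup>2 \<le> (exp (real m))\<^sup>2 * (exp (real m) * ?M ^ m)"
    by (simp only: power_mult_distrib) (meson mult_left_mono order_trans zero_le_power2)
  also have "\<dots> = exp (real m) ^ 3 * (real m ^ m)\<^sup>2 / 28 ^ m"
    by (simp add: power_divide eval_nat_numeral power_mult_distrib)
  finally have "28 ^ m \<le> exp (real m) ^ 3" using m by (simp add: field_simps)
  also have "\<dots> = (exp 1 ^ 3) ^ m" using exp_of_nat_mult[of m "1 :: real"]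
    by (simp flip: power_mult)
  also have "\<dots> \<le> (3 ^ 3) ^ m" using exp_le by (intro power_mono) auto
  also have "\<dots> < 28 ^ m" using m by (intro power_strict_mono) auto
  finally show False by simp
qed

text \<open>Colour classes of the forward graph on \<open>C\<close> are backward, so the inequality
  says that at least the stated number of colours is needed. Passing to a container \<open>C\<close>
  costs nothing, as only the ratio of \<open>card C\<close> to the class size matters.\<close>

lemma exists_ordering_small_backward:
  assumes ne: "V \<noteq> {}"
  shows "\<exists>C g. C \<subseteq> V \<and> C \<noteq> {} \<and> inj_on g C \<and> (\<forall>I\<subseteq>C. backward R g I \<longrightarrow>
    real (card I) * (real (card V) powr (5/9) / (2500 * (ln (real (card V) + 1))\<^sup>2)) \<le> real (card C))"
proof -
  let ?n = "real (card V)"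
  define L where "L = ln (?n + 1)"
  define X where "X = ?n powr (1/9)"
  have n: "1 \<le> card V" using ne finite_V by (simp add: Suc_le_eq card_gt_0_iff)
  have L: "1/2 \<le> L" using half_le_ln_Suc[OF n] by (simp add: L_def)
  have "(1/2)\<^sup>2 \<le> L\<^sup>2" using L by (intro power_mono) auto
  then have L2: "1/4 \<le> L\<^sup>2" by (simp add: power2_eq_square)
  have X: "1 \<le> X" unfolding X_def using n by (intro ge_one_powr_ge_zero) auto
  have X9: "X ^ 9 = ?n" and X5: "X ^ 5 = ?n powr (5/9)"
    using n by (simp_all add: X_def powr_power)
  define q where "q = X ^ 5 / (2500 * L\<^sup>2)"
  have q_le: "q \<le> X ^ 5 / 625"
    unfolding q_def using L2 X by (intro divide_left_mono) auto
  have q0: "0 \<le> q" using X by (simp add: q_def)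
  have "\<exists>C g. C \<subseteq> V \<and> C \<noteq> {} \<and> inj_on g C \<and> (\<forall>I\<subseteq>C. backward R g I \<longrightarrow>
    real (card I) * q \<le> real (card C))"
  \<comment> \<open>For small \<open>X\<close> the target \<open>q\<close> is below 1 and a single
    vertex suffices.\<close>
  proof (cases "X ^ 4 \<le> 28")
    case True
    have "X \<le> 3"
    proof (rule ccontr)
      assume "\<not> X \<le> 3"
      then have "3 ^ 4 \<le> X ^ 4" by (intro power_mono) auto
      then show False using True by simp
    qed
    then have "X ^ 5 \<le> 3 ^ 5" using X by (intro power_mono) auto
    then have q1: "q \<le> 1" using q_le by simp
    obtain v where v: "v \<in> V" using ne by blast
    have "real (card I) * q \<le> real (card {v})" if "I \<subseteq> {v}" for I
    proof -
      have "card I \<le> card {v}" using that by (intro card_mono) auto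
      then have "real (card I) * q \<le> 1 * 1" using q0 q1 by (intro mult_mono) auto
      then show ?thesis by simp
    qed
    then show ?thesis using v by (intro exI[of _ "{v}"] exI[of _ "\<lambda>_. 0"]) auto
  next
    case False
    define m where "m = nat \<lceil>X ^ 4\<rceil>"
    have X4: "0 < X ^ 4" using X by simp
    then have "real m = of_int \<lceil>X ^ 4\<rceil>" unfolding m_def by simp
    then have m: "X ^ 4 \<le> real m" "real m < X ^ 4 + 1" using ceiling_correct[of "X ^ 4"] by linarith+
    then have m28: "28 \<le> m" using False by linarith
    show ?thesis
    proof (cases "card (transitive_sets R V (\<lambda>_. 0) m) < fact m")
      case True
      from exists_ordering_of_few_transitive_sets[OF this] obtain g
        where g: "inj_on g V" and small: "\<forall>I\<subseteq>V. backward R g I \<longrightarrow> card I < m"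
        by (elim exE conjE)
      have "real (card I) * q \<le> ?n" if I: "I \<subseteq> V" "backward R g I" for I
      proof -
        have "card I < m" using small I by blast
        \<comment> \<open>\<open>m\<close> is the ceiling of \<open>X ^ 4\<close>, so an integer
          below \<open>m\<close> is below \<open>X ^ 4\<close> itself.\<close>
        then have "real (card I) \<le> X ^ 4" using m by linarith
        then have "real (card I) * q \<le> X ^ 4 * (X ^ 5 / 625)"
          using q_le q0 X by (intro mult_mono) auto
        also have "\<dots> = ?n / 625" using X9 by (simp flip: power_add)
        also have "\<dots> \<le> ?n" by simp
        finally show ?thesis .
      qed
      then show ?thesis using ne g by blast
    next
      case False
      then have many: "fact m \<le> card (transitive_sets R V (\<lambda>_. 0) m)" by simp
      \<comment> \<open>The container argument needs only order \<open>X ^ 5\<close> here. The sixth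
        power balances the two square roots: for \<open>c\<close> about \<open>X ^ 8\<close> both
        are about \<open>X ^ 3\<close> up to logarithms.\<close>
      define s where "s = 8 * X ^ 6 * L\<^sup>2"
      have "1 * (1/4) \<le> X ^ 6 * L\<^sup>2" using X L2 by (intro mult_mono) auto
      then have s1: "1 < s" by (simp add: s_def)
      have "8 * ?n * L\<^sup>2 / real m \<le> 8 * ?n * L\<^sup>2 / X ^ 4"
        by (intro frac_le m(1) X4) simp_all
      also have "\<dots> = 8 * (X ^ 9 / X ^ 4) * L\<^sup>2" using X9 by simp
      also have "X ^ 9 / X ^ 4 = X ^ 5" using power_diff[of X 4 9] X by simp
      also have "8 * X ^ 5 * L\<^sup>2 \<le> s" unfolding s_def using X by (intro mult_right_mono mult_left_mono power_increasing) auto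
      finally have s2: "8 * ?n * L\<^sup>2 / real m \<le> s" .
      from exists_sparse_levels[OF ne m28 many L_def s1 s2] obtain C f where C: "C \<subseteq> V"
        and large: "(real m)\<^sup>2 / 28 \<le> real (card C)"
        and conf: "\<forall>v\<in>C. real (card (conflicts R C f v)) \<le> 2 * L\<^sup>2 / real m * (real (card C) + 1)"
        and level: "\<forall>v\<in>C. real (card (level C f v)) \<le> s"
        by (elim exE conjE)
      let ?c = "real (card C)" and ?D = "2 * L\<^sup>2 / real m * (real (card C) + 1)"
      have "28\<^sup>2 / 28 \<le> (real m)\<^sup>2 / 28" using m28 by (intro divide_right_mono power_mono) auto
      then have c: "1 \<le> ?c" using large by (simp add: power2_eq_square)
      then have neC: "C \<noteq> {}" by auto
      interpret C: tournament_relation C R using C by (rule tournament_relation_subset)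
      have "0 \<le> ?D" by simp
      from C.exists_ordering_of_merged_levels[OF neC _ this, of s f] conf level s1
      obtain g where g: "inj_on g C" and small: "\<forall>I\<subseteq>C. backward R g I \<longrightarrow>
          real (card I) \<le> 2 * exp 2 * ln (?c + 1) * (sqrt (2 * s) + sqrt (?D * (?c / s + 1)))"
        by auto
      have "(X ^ 4)\<^sup>2 \<le> (real m)\<^sup>2" using m(1) X by (intro power_mono) auto
      then have cX: "X ^ 8 \<le> 28 * ?c" using large by (simp flip: power_mult)
      define B where "B = ?c * L / X ^ 5"
      have sqrts: "sqrt (2 * s) + sqrt (?D * (?c / s + 1)) \<le> 123 * B"
        unfolding s_def B_def using X L m(1) c cX by (rule sum_sqrt_le)
      have e: "exp 2 \<le> (9 :: real)"
      proof -
        have "exp 2 = (exp 1 :: real)\<^sup>2" using exp_double[of "1 :: real"] by simp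
        also have "\<dots> \<le> 3\<^sup>2" using exp_le by (intro power_mono) auto
        finally show ?thesis by simp
      qed
      have lnc: "ln (?c + 1) \<le> L"
        unfolding L_def using card_mono[OF finite_V C] by (intro ln_mono) auto
      have "real (card I) * q \<le> ?c" if I: "I \<subseteq> C" "backward R g I" for I
      proof -
        have "real (card I) \<le> 2 * exp 2 * ln (?c + 1) * (sqrt (2 * s) + sqrt (?D * (?c / s + 1)))"
          using small I by blast
        also have "\<dots> \<le> 2 * 9 * L * (123 * B)"
          using e lnc c sqrts L s1 by (intro mult_mono) auto
        finally have "real (card I) \<le> 2214 * L * B" by simp
        then have "real (card I) * q \<le> 2214 * L * B * q" using q0 by (rule mult_right_mono)
        \<comment> \<open>The constant 2500 in \<open>q\<close> was chosen above
          \<open>2 * 9 * 123 = 2214\<close>.\<close>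
        also have "\<dots> = 2214 / 2500 * ?c"
          using X L by (simp add: q_def B_def power2_eq_square)
        also have "\<dots> \<le> ?c" by simp
        finally show ?thesis .
      qed
      then show ?thesis using C neC g by blast
    qed
  qed
  then show ?thesis unfolding q_def X5 L_def .
qed

end

subsection \<open>Acyclic subgraphs from orderings\<close>

lemma tournament_relation_of_tournament:
  assumes "tournament G"
  shows "tournament_relation (verts G) (\<lambda>u v. u \<rightarrow>\<^bsub>G\<^esub> v)"
proof -
  interpret tournament G by fact
  show ?thesis
  proof
    show "\<not> x \<rightarrow>\<^bsub>G\<^esub> x" for x using adj_not_same by blast
    show "x \<rightarrow>\<^bsub>G\<^esub> y \<longleftrightarrow> \<not> y \<rightarrow>\<^bsub>G\<^esub> x" if "x \<in> verts G" "y \<in> verts G" "x \<noteq> y" for x y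
      using adjacent_iff[OF that(1,2)] no_opposite_arcs that(3) by blast
  qed simp
qed

text \<open>Take the arcs inside \<open>C\<close> along which \<open>g\<close> increases. Walks then
  increase \<open>g\<close>, so none closes up, and every colour class is backward; summing
  \<open>small\<close> over the classes bounds their number.\<close>

lemma exists_acyclic_subgraph_of_ordering:
  fixes G :: "('a, 'b) pre_digraph"
  assumes G: "tournament G" and C: "C \<subseteq> verts G" "C \<noteq> {}" and g: "inj_on g C"
    and small: "\<And>I. I \<subseteq> C \<Longrightarrow> backward (\<lambda>u v. u \<rightarrow>\<^bsub>G\<^esub> v) g I \<Longrightarrow> real (card I) * q \<le> real (card C)"
  shows "\<exists>H. subgraph H G \<and> acyclic_digraph H \<and> q \<le> real (oriented_chromatic_number H)"
proof -
  interpret G: tournament G by fact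
  define H where "H = \<lparr>verts = C,
    arcs = {e \<in> arcs G. tail G e \<in> C \<and> head G e \<in> C \<and> g (tail G e) < g (head G e)},
    tail = tail G, head = head G\<rparr>"
  have H [simp]: "verts H = C" "tail H = tail G" "head H = head G" by (simp_all add: H_def)
  have adj: "u \<rightarrow>\<^bsub>H\<^esub> v \<longleftrightarrow> u \<in> C \<and> v \<in> C \<and> g u < g v \<and> u \<rightarrow>\<^bsub>G\<^esub> v" for u v
    by (auto simp: H_def arcs_ends_conv)
  interpret H: wf_digraph H by unfold_locales (auto simp: H_def)
  have finC: "finite C" using C(1) G.finite_verts finite_subset by blast
  have "subgraph H G"
    using C(1) G.wf_digraph_axioms H.wf_digraph_axioms
    by (auto simp: subgraph_def compatible_def H_def)
  moreover have "acyclic_digraph H"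
  proof -
    have less: "g u < g v" if "H.awalk u p v" "p \<noteq> []" for u p v
      using that
    proof (induction p arbitrary: u)
      case (Cons e p)
      then have e: "e \<in> arcs H" "tail H e = u" "H.awalk (head H e) p v"
        by (auto simp: H.awalk_Cons_iff)
      then have step: "g u < g (head H e)" by (auto simp: H_def)
      show ?case
      proof (cases "p = []")
        case True
        then show ?thesis using step e(3) by (simp add: H.awalk_Nil_iff)
      next
        case False
        then show ?thesis using step Cons.IH[OF e(3)] by simp
      qed
    qed simp
    show ?thesis unfolding acyclic_digraph_def H.cycle_def using less by (meson less_irrefl)
  qed
  moreover have "q \<le> real (oriented_chromatic_number H)"
  proof -
    let ?U = "with_proj (mk_symmetric H)"
    let ?k = "oriented_chromatic_number H"
    have U: "verts ?U = C" by (simp add: mk_symmetric_def)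
    have proper_iff: "proper_coloring ?U k c \<longleftrightarrow>
        (\<forall>v\<in>C. c v < k) \<and> (\<forall>u v. u \<rightarrow>\<^bsub>H\<^esub> v \<longrightarrow> c u \<noteq> c v)" for k c
      unfolding proper_coloring_def arcs_ends_mk_symmetric_iff U by metis
    obtain b where b: "bij_betw b C {0..<card C}" using ex_bij_betw_finite_nat[OF finC] by blast
    have "proper_coloring ?U (card C) b"
      unfolding proper_iff adj using b by (auto simp: bij_betw_def inj_on_eq_iff)
    then have "\<exists>c. proper_coloring ?U ?k c"
      unfolding oriented_chromatic_number_def chromatic_number_def by (intro LeastI) blast
    then obtain c where c: "\<And>v. v \<in> C \<Longrightarrow> c v < ?k" "\<And>u v. u \<rightarrow>\<^bsub>H\<^esub> v \<Longrightarrow> c u \<noteq> c v"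
      unfolding proper_iff by blast
    have "backward (\<lambda>u v. u \<rightarrow>\<^bsub>G\<^esub> v) g {v \<in> C. c v = i}" for i
      unfolding backward_def
    proof (intro ballI impI)
      fix x y assume x: "x \<in> {v \<in> C. c v = i}" and y: "y \<in> {v \<in> C. c v = i}" and xy: "x \<rightarrow>\<^bsub>G\<^esub> y"
      have "\<not> x \<rightarrow>\<^bsub>H\<^esub> y" using c(2)[of x y] x y by auto
      then have "g y \<le> g x" using x y xy unfolding adj by auto
      \<comment> \<open>Injectivity of \<open>g\<close> excludes ties, so an arc that is not forward
        descends strictly.\<close>
      moreover have "g x \<noteq> g y" using g x y xy G.adj_not_same by (auto simp: inj_on_def)
      ultimately show "g y < g x" by simp
    qed
    then have colour_class: "real (card {v \<in> C. c v = i}) * q \<le> real (card C)" for i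
      by (intro small) auto
    have "c ` C \<subseteq> {..<?k}" using c(1) by blast
    then have "real (card C) = (\<Sum>i<?k. real (card {v \<in> C. c v = i}))"
      using sum.group[OF finC finite_lessThan[of ?k], of c "\<lambda>_. 1 :: real"] by simp
    then have "real (card C) * q = (\<Sum>i<?k. real (card {v \<in> C. c v = i}) * q)"
      by (simp only: sum_distrib_right)
    also have "\<dots> \<le> (\<Sum>i<?k. real (card C))" using colour_class by (rule sum_mono)
    also have "\<dots> = real (card C) * real ?k" by simp
    finally show ?thesis using finC C(2) by (simp add: card_gt_0_iff)
  qed
  ultimately show ?thesis by blast
qed

theorem theorem1p3:
  shows "\<exists>\<epsilon> :: nat \<Rightarrow> real. (\<forall>n. 0 \<le> \<epsilon> n) \<and> \<epsilon> \<longlonglongrightarrow> 0 \<and>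
    (\<forall>n\<ge>1. \<forall>G :: ('a, 'b) pre_digraph. tournament G \<and> card (verts G) = n \<longrightarrow>
      (\<exists>H. subgraph H G \<and> acyclic_digraph H \<and>
        real (oriented_chromatic_number H) \<ge> real n powr (5/9 - \<epsilon> n)))"
proof -
  \<comment> \<open>For \<open>n \<ge> 2\<close> the factor \<open>n powr \<epsilon> n\<close> is
    exactly the logarithmic loss. For \<open>n = 1\<close> the division by \<open>ln 1 = 0\<close>
    gives the value 0.\<close>
  define \<epsilon> where "\<epsilon> n = ln (2500 * (ln (real n + 1))\<^sup>2) / ln (real n)" for n :: nat
  have big: "1 \<le> 2500 * (ln (real n + 1))\<^sup>2" if "1 \<le> n" for n
  proof -
    have "(1/2)\<^sup>2 \<le> (ln (real n + 1))\<^sup>2" using half_le_ln_Suc[OF that] by (intro power_mono) auto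
    then show ?thesis by (simp add: power2_eq_square)
  qed
  have "0 \<le> \<epsilon> n" for n
    using big[of n] by (cases "n = 0") (auto simp: \<epsilon>_def intro!: divide_nonneg_nonneg)
  moreover have "\<epsilon> \<longlonglongrightarrow> 0" unfolding \<epsilon>_def by real_asymp
  moreover have "\<exists>H. subgraph H G \<and> acyclic_digraph H \<and>
      real n powr (5/9 - \<epsilon> n) \<le> real (oriented_chromatic_number H)"
    if n: "1 \<le> n" and G: "tournament G" and card: "card (verts G) = n"
    for n and G :: "('a, 'b) pre_digraph"
  proof -
    interpret T: tournament_relation "verts G" "\<lambda>u v. u \<rightarrow>\<^bsub>G\<^esub> v"
      using G by (rule tournament_relation_of_tournament)
    have ne: "verts G \<noteq> {}" using n card by auto
    show ?thesis
    \<comment> \<open>For \<open>n = 1\<close> the required bound is 1 whatever the exponent, and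
      the whole one-vertex tournament meets it.\<close>
    proof (cases "n = 1")
      case True
      obtain g :: "'a \<Rightarrow> nat" where g: "inj_on g (verts G)"
        using finite_imp_inj_to_nat_seg[OF T.finite_V] by blast
      show ?thesis
        using T.finite_V True
        by (intro exists_acyclic_subgraph_of_ordering[OF G order.refl ne g]) (auto intro: card_mono)
    next
      case False
      then have "real n powr (5/9 - \<epsilon> n) = real n powr (5/9) / (2500 * (ln (real n + 1))\<^sup>2)"
        using n big[OF n] by (simp add: powr_diff \<epsilon>_def) (simp add: powr_def)
      moreover from T.exists_ordering_small_backward[OF ne]
      obtain C g where "C \<subseteq> verts G" "C \<noteq> {}" "inj_on g C" "\<forall>I\<subseteq>C. backward (\<lambda>u v. u \<rightarrow>\<^bsub>G\<^esub> v) g I \<longrightarrow>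
        real (card I) * (real n powr (5/9) / (2500 * (ln (real n + 1))\<^sup>2)) \<le> real (card C)"
        unfolding card by (elim exE conjE)
      ultimately show ?thesis using exists_acyclic_subgraph_of_ordering[OF G] by simp
    qed
  qed
  ultimately show ?thesis by blast
qed

end
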